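(* Let $s, t \geq 2$ be integers. Every $K^{\ast}_{s,t}$-minor-free graph $G$ is isomorphic to a subgraph of $H \boxtimes P \boxtimes K_m$ for some path $P$ and some graph $H$ of simple treewidth at most $s$, where $m := (t-1)\,\mathrm{ltw}(G)$.
   Context: All graphs are finite, simple and undirected. $K^{\ast}_{s,t}$ is the graph whose vertex-set is partitioned into $A \cup B$ with $|A| = s$, $|B| = t$, $A$ a clique, $B$ an independent set, and every vertex of $A$ adjacent to every vertex of $B$. A tree-decomposition is $k$-simple if it has width at most $k$ (all bags of size at most $k+1$) and every set of $k$ vertices is contained in at most two bags; the simple treewidth of a graph is the minimum $k\in\mathbb{N}$ such that it has a $k$-simple tree-decomposition. A layering of $G$ is a partition $(V_1, V_2, \dots)$ of $V(G)$ such that for each edge $vw$ with $v \in V_i$, $w \in V_j$ we have $|i-j| \leq 1$. The layered treewidth $\mathrm{ltw}(G)$ is the minimum integer $k$ such that $G$ has a layering $\mathcal{L}$ and a tree-decomposition $(T,\mathcal{W})$ with $|L \cap W| \leq k$ for every layer $L$ and every bag $W$. The strong product $A \boxtimes B$ has vertex-set $V(A)\times V(B)$, where distinct $(v,x),(w,y)$ are adjacent if ($v=w$ and $xy\in E(B)$), or ($x=y$ and $vw\in E(A)$), or ($vw\in E(A)$ and $xy\in E(B)$). $K_m$ is the complete graph on $m$ vertices. *)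

theory Defs
  imports
    "Graph_Theory.Pair_Digraph"
    "Graph_Theory.Digraph_Component"
    "Graph_Theory.Digraph_Isomorphism"
    "Graph_Theory.Kuratowski"
begin

text \<open>
  A finite simple undirected graph is a term satisfying \<^const>\<open>pair_graph\<close>: finite, loop-free,
  with a symmetric set of arcs, so that an edge \<open>vw\<close> is the pair of arcs \<open>(v, w)\<close>, \<open>(w, v)\<close>.
  The library notion \<^const>\<open>subgraph\<close> is the one for digraphs; a subgraph of an undirected
  graph must in addition be symmetric, hence the extra \<^const>\<open>pair_graph\<close> below.
\<close>

definition contained_in :: "'a pair_pre_digraph \<Rightarrow> 'b pair_pre_digraph \<Rightarrow> bool" where
  "contained_in G X \<longleftrightarrow>
    (\<exists>S. pair_graph S \<and> subgraph (with_proj S) (with_proj X) \<and>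
      digraph_iso (with_proj G) (with_proj S))"


text \<open>The vertex that results from contracting the edge \<open>vw\<close> is again called \<open>v\<close>.\<close>

definition contract_edge :: "'a pair_pre_digraph \<Rightarrow> 'a \<Rightarrow> 'a \<Rightarrow> 'a pair_pre_digraph" where
  "contract_edge G v w =
    (let f = (\<lambda>x. if x = w then v else x)
     in \<lparr> pverts = f ` pverts G,
          parcs = {(f x, f y) | x y. (x, y) \<in> parcs G \<and> f x \<noteq> f y} \<rparr>)"

definition contracts_to :: "'a pair_pre_digraph \<Rightarrow> 'a pair_pre_digraph \<Rightarrow> bool" where
  "contracts_to G G' \<longleftrightarrow> (\<exists>v w. (v, w) \<in> parcs G \<and> G' = contract_edge G v w)"

definition minor_of :: "'b pair_pre_digraph \<Rightarrow> 'a pair_pre_digraph \<Rightarrow> bool" where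
  "minor_of K G \<longleftrightarrow>
    (\<exists>S M. pair_graph S \<and> subgraph (with_proj S) (with_proj G) \<and>
      contracts_to\<^sup>*\<^sup>* S M \<and> digraph_iso (with_proj K) (with_proj M))"

definition Kstar :: "nat \<Rightarrow> nat \<Rightarrow> 'a pair_pre_digraph \<Rightarrow> bool" where
  "Kstar s t K \<longleftrightarrow>
    pair_graph K \<and>
    (\<exists>A B. pverts K = A \<union> B \<and> A \<inter> B = {} \<and> card A = s \<and> card B = t \<and>
      parcs K = {(u, v). u \<in> A \<and> v \<in> A \<and> u \<noteq> v} \<union> A \<times> B \<union> B \<times> A)"

definition Kstar_minor_free :: "nat \<Rightarrow> nat \<Rightarrow> 'a pair_pre_digraph \<Rightarrow> bool" where
  "Kstar_minor_free s t G \<longleftrightarrow>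
    \<not> (\<exists>K :: nat pair_pre_digraph. Kstar s t K \<and> minor_of K G)"


text \<open>
  The library's \<^const>\<open>tree\<close> is not the right notion for symmetric digraphs, as it regards the
  two arcs \<open>(v, w)\<close>, \<open>(w, v)\<close> of an edge as a cycle. The cycles of an undirected graph are the
  directed cycles of length at least three.
\<close>

definition undirected_tree :: "'a pair_pre_digraph \<Rightarrow> bool" where
  "undirected_tree T \<longleftrightarrow>
    pair_graph T \<and> connected (with_proj T) \<and>
    \<not> (\<exists>p. pre_digraph.cycle (with_proj T) p \<and> 3 \<le> length p)"

text \<open>Note that \<^const>\<open>connected\<close> includes non-emptiness.\<close>

definition tree_decomposition ::
    "'a pair_pre_digraph \<Rightarrow> 'n pair_pre_digraph \<Rightarrow> ('n \<Rightarrow> 'a set) \<Rightarrow> bool" where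
  "tree_decomposition G T W \<longleftrightarrow>
    undirected_tree T \<and>
    (\<forall>x \<in> pverts T. W x \<subseteq> pverts G) \<and>
    (\<forall>(v, w) \<in> parcs G. \<exists>x \<in> pverts T. v \<in> W x \<and> w \<in> W x) \<and>
    (\<forall>v \<in> pverts G. connected (with_proj T \<restriction> {x \<in> pverts T. v \<in> W x}))"

text \<open>Bags are counted as nodes of the tree, i.e. with multiplicity.\<close>

definition k_simple ::
    "nat \<Rightarrow> 'a pair_pre_digraph \<Rightarrow> 'n pair_pre_digraph \<Rightarrow> ('n \<Rightarrow> 'a set) \<Rightarrow> bool" where
  "k_simple k G T W \<longleftrightarrow>
    (\<forall>x \<in> pverts T. card (W x) \<le> k + 1) \<and>
    (\<forall>S. S \<subseteq> pverts G \<and> card S = k \<longrightarrow> card {x \<in> pverts T. S \<subseteq> W x} \<le> 2)"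

definition simple_treewidth :: "'a pair_pre_digraph \<Rightarrow> nat" where
  "simple_treewidth G =
    (LEAST k. \<exists>(T :: nat pair_pre_digraph) W. tree_decomposition G T W \<and> k_simple k G T W)"

text \<open>Layers are indexed from \<open>0\<close> and may be empty.\<close>

definition layering :: "'a pair_pre_digraph \<Rightarrow> (nat \<Rightarrow> 'a set) \<Rightarrow> bool" where
  "layering G L \<longleftrightarrow>
    (\<Union>i. L i) = pverts G \<and>
    (\<forall>i j. i \<noteq> j \<longrightarrow> L i \<inter> L j = {}) \<and>
    (\<forall>(v, w) \<in> parcs G. \<forall>i j. v \<in> L i \<and> w \<in> L j \<longrightarrow> \<bar>int i - int j\<bar> \<le> 1)"

definition layered_treewidth :: "'a pair_pre_digraph \<Rightarrow> nat" where
  "layered_treewidth G =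
    (LEAST k. \<exists>L (T :: nat pair_pre_digraph) W.
      layering G L \<and> tree_decomposition G T W \<and>
      (\<forall>i. \<forall>x \<in> pverts T. card (L i \<inter> W x) \<le> k))"


definition path_graph :: "'a pair_pre_digraph \<Rightarrow> bool" where
  "path_graph P \<longleftrightarrow>
    (\<exists>vs. vs \<noteq> [] \<and> distinct vs \<and> pverts P = set vs \<and>
      parcs P = {(u, v). \<exists>i. Suc i < length vs \<and>
        ((u = vs ! i \<and> v = vs ! Suc i) \<or> (u = vs ! Suc i \<and> v = vs ! i))})"

definition strong_product ::
    "'a pair_pre_digraph \<Rightarrow> 'b pair_pre_digraph \<Rightarrow> ('a \<times> 'b) pair_pre_digraph"
    (infixl \<open>\<boxtimes>\<close> 70) where
  "A \<boxtimes> B =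
    \<lparr> pverts = pverts A \<times> pverts B,
      parcs = {((v, x), (w, y)).
        (v, x) \<in> pverts A \<times> pverts B \<and> (w, y) \<in> pverts A \<times> pverts B \<and> (v, x) \<noteq> (w, y) \<and>
        ((v = w \<and> (x, y) \<in> parcs B) \<or>
         (x = y \<and> (v, w) \<in> parcs A) \<or>
         ((v, w) \<in> parcs A \<and> (x, y) \<in> parcs B))} \<rparr>"

end

theory Submission
  imports Defs "HOL-Library.Disjoint_Sets"
begin

text \<open>
  Fix a layering and a tree-decomposition that attain the layered treewidth. It suffices to
  partition \<open>V(G)\<close> into parts, each contained in the union of at most \<open>t - 1\<close> bags, such that the
  quotient is a subgraph of a graph \<open>H\<close> of simple treewidth at most \<open>s\<close>: every part then has at
  most \<open>(t - 1) ltw(G)\<close> vertices in each layer.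

  The parts are created recursively. A subproblem consists of a set \<open>D\<close> of unassigned vertices whose
  neighbours lie in at most \<open>s\<close> existing parts, together with a model of a clique outside \<open>D\<close> whose
  branch sets contain these neighbours, one branch set for each part. Call a connected subset of \<open>D\<close>
  linked if it touches all branch sets. If there are \<open>s\<close> branch sets, then \<open>t\<close> disjoint linked sets
  would give a \<open>K*(s,t)\<close> minor, so by the Erdos-Posa property of subtrees at most \<open>t - 1\<close> bags hit
  all linked sets. The new part is a minimal hitting set \<open>X\<close> inside these bags. The components of
  \<open>D - X\<close> are grouped into subproblems according to the set \<open>L\<close> of branch sets that they touch. Some
  branch set does not belong to \<open>L\<close>, and by minimality of \<open>X\<close> it can be enlarged by all of \<open>X\<close>
  without meeting the components of the group; so \<open>L\<close> together with \<open>X\<close> is again a clique of at most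
  \<open>s\<close> parts. With fewer than \<open>s\<close> branch sets there is a linked set \<open>Q\<close> such that a single bag hits,
  inside \<open>Q\<close>, all linked sets meeting \<open>Q\<close>, and \<open>Q\<close> can serve as the branch set of the new part for
  the components that touch all branch sets.

  A clique of \<open>s\<close> parts gives rise to only one new part, which makes the resulting
  tree-decomposition of \<open>H\<close> \<open>s\<close>-simple.
\<close>

section \<open>Connected sets\<close>

definition connected_on :: "('a \<times> 'a) set \<Rightarrow> 'a set \<Rightarrow> bool" where
  "connected_on E S \<longleftrightarrow> (\<forall>x \<in> S. \<forall>y \<in> S. (x, y) \<in> rtrancl_on S E)"

definition reach :: "('a \<times> 'a) set \<Rightarrow> 'a set \<Rightarrow> 'a set \<Rightarrow> 'a set" where
  "reach E D A = rtrancl_on D E `` A"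

definition touches :: "('a \<times> 'a) set \<Rightarrow> 'a set \<Rightarrow> 'a set \<Rightarrow> bool" where
  "touches E A B \<longleftrightarrow> (\<exists>a \<in> A. \<exists>b \<in> B. (a, b) \<in> E)"

lemma touches_sym: "sym E \<Longrightarrow> touches E A B \<Longrightarrow> touches E B A"
  unfolding touches_def by (meson symD)

lemma touches_mono: "touches E A B \<Longrightarrow> A \<subseteq> A' \<Longrightarrow> B \<subseteq> B' \<Longrightarrow> touches E A' B'"
  unfolding touches_def by blast

lemma connected_on_singleton: "connected_on E {x}"
  by (simp add: connected_on_def)

lemma connected_onI_root:
  assumes "sym E" "\<And>y. y \<in> S \<Longrightarrow> (x, y) \<in> rtrancl_on S E"
  shows "connected_on E S"
  unfolding connected_on_def
proof (intro ballI)
  fix y z assume "y \<in> S" "z \<in> S"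
  then have "(y, x) \<in> rtrancl_on S E" "(x, z) \<in> rtrancl_on S E"
    using assms(2) symD[OF rtrancl_on_sym[OF assms(1)]] by blast+
  then show "(y, z) \<in> rtrancl_on S E" by (rule rtrancl_on_trans)
qed

lemma connected_on_subsetI:
  assumes "connected_on E S" "S \<inter> Z \<noteq> {}"
    and closed: "\<And>x y. x \<in> S \<Longrightarrow> x \<in> Z \<Longrightarrow> y \<in> S \<Longrightarrow> (x, y) \<in> E \<Longrightarrow> y \<in> Z"
  shows "S \<subseteq> Z"
proof
  fix y assume "y \<in> S"
  obtain x where x: "x \<in> S" "x \<in> Z" using assms(2) by blast
  have "(x, y) \<in> rtrancl_on S E" using assms(1) x(1) \<open>y \<in> S\<close> by (simp add: connected_on_def)
  then show "y \<in> Z"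
  proof (induction rule: rtrancl_on_induct)
    case (step y z)
    then show ?case using closed[of y z] by blast
  qed (use x in simp)
qed

lemma connected_on_image:
  assumes "connected_on E S"
    and "\<And>x y. x \<in> S \<Longrightarrow> y \<in> S \<Longrightarrow> (x, y) \<in> E \<Longrightarrow> h x = h y \<or> (h x, h y) \<in> E'"
  shows "connected_on E' (h ` S)"
proof -
  have "(h x, h y) \<in> rtrancl_on (h ` S) E'" if "(x, y) \<in> rtrancl_on S E" for x y
    using that
  proof (induction rule: rtrancl_on_induct)
    case (step y z)
    then show ?case using assms(2)[of y z] by (auto intro: rtrancl_on_into_rtrancl_on)
  qed simp
  then show ?thesis using assms(1) by (auto simp: connected_on_def)
qed

lemma connected_on_UN:
  assumes "connected_on E I" "\<And>i. i \<in> I \<Longrightarrow> connected_on E' (N i)"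
    and meet: "\<And>i j. i \<in> I \<Longrightarrow> j \<in> I \<Longrightarrow> (i, j) \<in> E \<Longrightarrow> N i \<inter> N j \<noteq> {}"
  shows "connected_on E' (\<Union>i \<in> I. N i)"
proof -
  let ?R = "rtrancl_on (\<Union>i \<in> I. N i) E'"
  have within: "(x, y) \<in> ?R" if "i \<in> I" "x \<in> N i" "y \<in> N i" for i x y
    using assms(2)[OF that(1)] that rtrancl_on_mono[of E' E' "N i" "\<Union>i \<in> I. N i"]
    unfolding connected_on_def by blast
  have "(x, y) \<in> ?R" if "(i, j) \<in> rtrancl_on I E" "x \<in> N i" "y \<in> N j" for i j x y
    using that
  proof (induction arbitrary: y rule: rtrancl_on_induct)
    case (step j k)
    then obtain c where "c \<in> N j" "c \<in> N k" using meet by blast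
    then show ?case using step within[of k c y] rtrancl_on_trans by metis
  qed (use within in blast)
  then show ?thesis using assms(1) unfolding connected_on_def by blast
qed

lemma connected_on_insert:
  assumes "sym E" "connected_on E S" "a \<in> S" "(a, z) \<in> E"
  shows "connected_on E (insert z S)"
proof (rule connected_onI_root[OF assms(1), of _ a])
  fix y assume "y \<in> insert z S"
  moreover have "(a, z) \<in> rtrancl_on (insert z S) E"
    using assms(3,4) by (auto intro: rtrancl_on_into_rtrancl_on[of a a])
  moreover have "(a, y) \<in> rtrancl_on (insert z S) E" if "y \<in> S"
    using assms(2,3) that rtrancl_on_mono[of E E S "insert z S"]
    unfolding connected_on_def by blast
  ultimately show "(a, y) \<in> rtrancl_on (insert z S) E" by blast
qed

lemma finite_connected_induct [consumes 4, case_names singleton insert]: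
  assumes "sym E" "finite S" "connected_on E S" "r \<in> S"
    and singleton: "P {r}"
    and insert: "\<And>Z a z. Z \<subseteq> S \<Longrightarrow> connected_on E Z \<Longrightarrow> a \<in> Z \<Longrightarrow> z \<in> S - Z \<Longrightarrow> (a, z) \<in> E \<Longrightarrow>
      P Z \<Longrightarrow> P (insert z Z)"
  shows "P S"
proof -
  let ?Q = "\<lambda>Z. Z \<subseteq> S \<and> r \<in> Z \<and> connected_on E Z \<and> P Z"
  have "finite {Z. ?Q Z}" using assms(2) by simp
  moreover have "{r} \<in> {Z. ?Q Z}" using assms(4) singleton by (simp add: connected_on_singleton)
  ultimately obtain Z where Z: "?Q Z" and max: "\<And>Z'. ?Q Z' \<Longrightarrow> Z \<subseteq> Z' \<Longrightarrow> Z = Z'"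
    using finite_has_maximal2[of "{Z. ?Q Z}" "{r}"] by auto
  have "S \<subseteq> Z"
  proof (rule connected_on_subsetI[OF assms(3)])
    show "S \<inter> Z \<noteq> {}" using Z by blast
    fix x y assume xy: "x \<in> S" "x \<in> Z" "y \<in> S" "(x, y) \<in> E"
    show "y \<in> Z"
    proof (rule ccontr)
      assume "y \<notin> Z"
      then have "?Q (insert y Z)"
        using Z xy insert[of Z x y] connected_on_insert[OF \<open>sym E\<close>, of Z x y] by blast
      then show False using max[of "insert y Z"] \<open>y \<notin> Z\<close> by blast
    qed
  qed
  then have "Z = S" using Z by blast
  then show ?thesis using Z by blast
qed

lemma reach_subset: "reach E D A \<subseteq> D"
  unfolding reach_def by (auto dest: in_rtrancl_on_in_F)

lemma subset_reach: "A \<subseteq> D \<Longrightarrow> A \<subseteq> reach E D A"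
  unfolding reach_def by auto

lemma reach_closed: "x \<in> reach E D A \<Longrightarrow> (x, y) \<in> E \<Longrightarrow> y \<in> D \<Longrightarrow> y \<in> reach E D A"
  unfolding reach_def by (auto intro: rtrancl_on_into_rtrancl_on)

lemma reach_singleton_eq:
  assumes "sym E" "x \<in> reach E D {u}"
  shows "reach E D {x} = reach E D {u}"
proof -
  have "(u, x) \<in> rtrancl_on D E" "(x, u) \<in> rtrancl_on D E"
    using assms rtrancl_on_sym[OF assms(1), of D] by (auto simp: reach_def dest: symD)
  then show ?thesis unfolding reach_def by (auto intro: rtrancl_on_trans)
qed

lemma connected_on_reach:
  assumes "sym E" "connected_on E A" "A \<subseteq> D"
  shows "connected_on E (reach E D A)"
proof -
  let ?M = "reach E D A"
  have from_A: "(x, y) \<in> rtrancl_on ?M E" if "(x, y) \<in> rtrancl_on D E" "x \<in> A" for x y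
    using that
  proof (induction rule: rtrancl_on_induct)
    case base
    then show ?case using subset_reach[OF assms(3)] by auto
  next
    case (step y z)
    then have "z \<in> ?M" by (auto simp: reach_def intro: rtrancl_on_into_rtrancl_on)
    then show ?case using step by (auto intro: rtrancl_on_into_rtrancl_on)
  qed
  have within_A: "(x, y) \<in> rtrancl_on ?M E" if "x \<in> A" "y \<in> A" for x y
    using assms(2,3) that from_A rtrancl_on_mono[of E E A D] unfolding connected_on_def by blast
  show ?thesis
  proof (cases "A = {}")
    case True
    then show ?thesis by (simp add: reach_def connected_on_def)
  next
    case False
    then obtain a where "a \<in> A" by blast
    show ?thesis
    proof (rule connected_onI_root[OF assms(1), of _ a])
      fix y assume "y \<in> ?M"
      then obtain x where "x \<in> A" "(x, y) \<in> rtrancl_on D E" by (auto simp: reach_def)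
      then show "(a, y) \<in> rtrancl_on ?M E" using within_A from_A \<open>a \<in> A\<close> rtrancl_on_trans by metis
    qed
  qed
qed

section \<open>Undirected graphs\<close>

lemma pair_graphI:
  assumes "finite (pverts G)" "parcs G \<subseteq> pverts G \<times> pverts G" "sym (parcs G)" "irrefl (parcs G)"
  shows "pair_graph G"
proof -
  have "finite (parcs G)" using assms(1,2) by (meson finite_SigmaI finite_subset)
  then show ?thesis using assms by unfold_locales (auto simp: symmetric_def irrefl_def)
qed

lemma pair_graph_sym: "pair_graph G \<Longrightarrow> sym (parcs G)"
  by (simp add: pair_graph_def pair_pseudo_graph_def pair_sym_digraph_def
      pair_sym_digraph_axioms_def symmetric_def)

lemma pair_graph_finite: "pair_graph G \<Longrightarrow> finite (pverts G)"
  by (simp add: pair_graph_def pair_digraph_def pair_fin_digraph_def pair_fin_digraph_axioms_def)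

lemma pair_graph_wf_digraph: "pair_graph G \<Longrightarrow> wf_digraph (with_proj G)"
  by (simp add: wf_digraph_wp_iff pair_graph_def pair_digraph_def pair_fin_digraph_def)

lemma pair_graph_arcsD:
  assumes "pair_graph G" "(x, y) \<in> parcs G"
  shows "x \<in> pverts G" "y \<in> pverts G" "x \<noteq> y" "(y, x) \<in> parcs G"
proof -
  interpret pair_graph G by fact
  show "x \<in> pverts G" "y \<in> pverts G" "x \<noteq> y" "(y, x) \<in> parcs G"
    using assms(2) in_arcsD1 in_arcsD2 no_loops' arcs_symmetric by auto
qed

lemma rtrancl_on_Restr: "rtrancl_on S (Restr E S) = rtrancl_on S E"
proof (intro subset_antisym subrelI)
  fix x y assume "(x, y) \<in> rtrancl_on S E"
  then show "(x, y) \<in> rtrancl_on S (Restr E S)"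
    by (induction rule: rtrancl_on_induct) (auto intro: rtrancl_on_into_rtrancl_on)
qed (auto intro: rtrancl_on_mono[of "Restr E S" E S S])

lemma connected_induce_iff:
  fixes G :: "'a pair_pre_digraph"
  assumes "sym (parcs G)"
  shows "connected (with_proj G \<restriction> M) \<longleftrightarrow> M \<noteq> {} \<and> connected_on (parcs G) M"
proof -
  have "mk_symmetric (with_proj G \<restriction> M) = \<lparr>pverts = M, parcs = Restr (parcs G) M\<rparr>"
    using assms unfolding mk_symmetric_def sym_def by auto
  then show ?thesis
    by (simp add: connected_def strongly_connected_def connected_on_def reachable_def
        rtrancl_on_Restr)
qed

lemma connected_pair_graph_iff:
  fixes G :: "'a pair_pre_digraph"
  assumes "pair_graph G"
  shows "connected (with_proj G) \<longleftrightarrow> pverts G \<noteq> {} \<and> connected_on (parcs G) (pverts G)"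
proof -
  have "with_proj G \<restriction> pverts G = with_proj G"
    using pair_graph_arcsD[OF assms] by (auto simp: induce_subgraph_def with_proj_def)
  then show ?thesis using connected_induce_iff[OF pair_graph_sym[OF assms], of "pverts G"] by simp
qed

lemma subgraph_with_projI:
  assumes "pair_graph A" "pair_graph B" "pverts A \<subseteq> pverts B" "parcs A \<subseteq> parcs B"
  shows "subgraph (with_proj A) (with_proj B)"
  unfolding subgraph_def compatible_def using assms by (simp add: pair_graph_wf_digraph)

section \<open>Quotients, models and minors\<close>

definition quotient_graph :: "('a \<Rightarrow> 'b) \<Rightarrow> 'a pair_pre_digraph \<Rightarrow> 'b pair_pre_digraph" where
  "quotient_graph f G =
    \<lparr>pverts = f ` pverts G, parcs = {(f x, f y) | x y. (x, y) \<in> parcs G \<and> f x \<noteq> f y}\<rparr>"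

lemma pverts_quotient_graph [simp]: "pverts (quotient_graph f G) = f ` pverts G"
  by (simp add: quotient_graph_def)

lemma quotient_graph_arcI:
  "(x, y) \<in> parcs G \<Longrightarrow> f x \<noteq> f y \<Longrightarrow> (f x, f y) \<in> parcs (quotient_graph f G)"
  unfolding quotient_graph_def by auto

lemma quotient_graph_arcE:
  assumes "(a, b) \<in> parcs (quotient_graph f G)"
  obtains x y where "(x, y) \<in> parcs G" "a = f x" "b = f y" "f x \<noteq> f y"
  using assms unfolding quotient_graph_def by auto

lemma pair_graph_quotient_graph:
  assumes "pair_graph G"
  shows "pair_graph (quotient_graph f G)"
proof (rule pair_graphI)
  show "finite (pverts (quotient_graph f G))" using pair_graph_finite[OF assms] by simp
  show "parcs (quotient_graph f G) \<subseteq> pverts (quotient_graph f G) \<times> pverts (quotient_graph f G)"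
    using pair_graph_arcsD[OF assms] by (auto elim!: quotient_graph_arcE)
  show "sym (parcs (quotient_graph f G))"
    using pair_graph_arcsD(4)[OF assms]
    by (auto intro!: symI intro: quotient_graph_arcI elim!: quotient_graph_arcE)
  show "irrefl (parcs (quotient_graph f G))"
    by (auto simp: irrefl_def elim!: quotient_graph_arcE)
qed

lemma quotient_graph_quotient_graph:
  "quotient_graph f (quotient_graph h G) = quotient_graph (f \<circ> h) G"
  by (auto simp: quotient_graph_def image_comp) metis+

lemma quotient_graph_ident:
  assumes "pair_graph G" "\<And>x. x \<in> pverts G \<Longrightarrow> f x = x"
  shows "quotient_graph f G = G"
proof -
  have "f x = x" "f y = y" "x \<noteq> y" if "(x, y) \<in> parcs G" for x y
    using pair_graph_arcsD[OF assms(1) that] assms(2) by auto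
  then have "parcs (quotient_graph f G) = parcs G"
    unfolding quotient_graph_def by auto metis
  then show ?thesis using assms(2) by simp
qed

lemma digraph_iso_quotient_graph:
  assumes "pair_graph G" "inj_on f (pverts G)"
  shows "digraph_iso (with_proj G) (with_proj (quotient_graph f G))"
proof -
  let ?h = "\<lparr>iso_verts = f, iso_arcs = map_prod f f, iso_head = snd, iso_tail = fst\<rparr>"
  have "f x \<noteq> f y" if "(x, y) \<in> parcs G" for x y
    using assms(2) pair_graph_arcsD[OF assms(1) that] by (meson inj_onD)
  then have "parcs (quotient_graph f G) = map_prod f f ` parcs G"
    by (auto simp: quotient_graph_def)
  then have "with_proj (quotient_graph f G) = app_iso ?h (with_proj G)"
    by (simp add: app_iso_def with_proj_def)
  moreover have "inj_on (map_prod f f) (parcs G)"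
    using assms(2) pair_graph_arcsD[OF assms(1)] by (auto simp: inj_on_def)
  then have "pre_digraph.digraph_isomorphism (with_proj G) ?h"
    unfolding pre_digraph.digraph_isomorphism_def
    using assms(2) pair_graph_wf_digraph[OF assms(1)] by auto
  ultimately show ?thesis unfolding digraph_iso_def by blast
qed

lemma digraph_iso_quotient_graph_sym:
  assumes "pair_graph G" "inj_on f (pverts G)"
  shows "digraph_iso (with_proj (quotient_graph f G)) (with_proj G)"
proof -
  let ?g = "the_inv_into (pverts G) f"
  have "quotient_graph ?g (quotient_graph f G) = G"
    using assms by (simp add: quotient_graph_quotient_graph quotient_graph_ident the_inv_into_f_f)
  moreover have "inj_on ?g (pverts (quotient_graph f G))"
    using inj_on_the_inv_into[OF assms(2)] by simp
  ultimately show ?thesis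
    using digraph_iso_quotient_graph[OF pair_graph_quotient_graph[OF assms(1)], of ?g f] by simp
qed

lemma connected_on_fibre_quotient_graph:
  assumes "f \<circ> h = f" "connected_on (parcs G) {x \<in> pverts G. f x = l}"
  shows "connected_on (parcs (quotient_graph h G)) {x \<in> pverts (quotient_graph h G). f x = l}"
proof -
  have "f (h x) = f x" for x using assms(1) by (metis comp_apply)
  then have "{x \<in> pverts (quotient_graph h G). f x = l} = h ` {x \<in> pverts G. f x = l}" by auto
  then show ?thesis
    using connected_on_image[OF assms(2), of h] quotient_graph_arcI[of _ _ G h] by metis
qed

lemma contracts_to_quotient_graph:
  assumes "pair_graph S" "\<And>l. connected_on (parcs S) {x \<in> pverts S. f x = l}"
  shows "\<exists>M. contracts_to\<^sup>*\<^sup>* S M \<and> digraph_iso (with_proj (quotient_graph f S)) (with_proj M)"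
  using assms
proof (induction "card (pverts S)" arbitrary: S rule: less_induct)
  case less
  show ?case
  proof (cases "inj_on f (pverts S)")
    case True
    then show ?thesis using digraph_iso_quotient_graph_sym[OF less.prems(1)] by blast
  next
    case False
    then obtain v b where vb: "v \<in> pverts S" "b \<in> pverts S" "f v = f b" "v \<noteq> b"
      unfolding inj_on_def by blast
    have "\<exists>w \<in> pverts S. f w = f v \<and> (v, w) \<in> parcs S"
      using connected_on_subsetI[OF less.prems(2)[of "f v"], of "{v}"] vb by auto
    then obtain w where w: "w \<in> pverts S" "f w = f v" "(v, w) \<in> parcs S" by blast
    define h where "h = (\<lambda>x. if x = w then v else x)"
    have contract: "contract_edge S v w = quotient_graph h S"
      by (simp add: contract_edge_def quotient_graph_def h_def)
    have fh: "f \<circ> h = f" using w(2) by (auto simp: h_def)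
    have "w \<notin> h ` pverts S" using pair_graph_arcsD(3)[OF less.prems(1) w(3)] by (auto simp: h_def)
    moreover have "h ` pverts S \<subseteq> pverts S" using vb(1) by (auto simp: h_def)
    ultimately have "card (pverts (quotient_graph h S)) < card (pverts S)"
      using w(1) pair_graph_finite[OF less.prems(1)] by (auto intro!: psubset_card_mono)
    then obtain M where "contracts_to\<^sup>*\<^sup>* (quotient_graph h S) M"
      "digraph_iso (with_proj (quotient_graph f (quotient_graph h S))) (with_proj M)"
      using less.hyps[OF _ pair_graph_quotient_graph[OF less.prems(1)]]
        connected_on_fibre_quotient_graph[OF fh less.prems(2)] by blast
    moreover have "contracts_to S (quotient_graph h S)"
      unfolding contracts_to_def using w(3) contract by metis
    ultimately show ?thesis
      using converse_rtranclp_into_rtranclp[of contracts_to S]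
      by (auto simp: quotient_graph_quotient_graph fh)
  qed
qed

definition model_in ::
    "'a pair_pre_digraph \<Rightarrow> 'i pair_pre_digraph \<Rightarrow> ('i \<Rightarrow> 'a set) \<Rightarrow> bool" where
  "model_in G H V \<longleftrightarrow>
    (\<forall>i \<in> pverts H. V i \<subseteq> pverts G \<and> V i \<noteq> {} \<and> connected_on (parcs G) (V i)) \<and>
    disjoint_family_on V (pverts H) \<and>
    (\<forall>(i, j) \<in> parcs H. touches (parcs G) (V i) (V j))"

lemma model_inD:
  assumes "model_in G H V" "i \<in> pverts H"
  shows "V i \<subseteq> pverts G" "V i \<noteq> {}" "connected_on (parcs G) (V i)"
  using assms by (auto simp: model_in_def)

lemma model_in_index_exists:
  assumes "model_in G H V"
  shows "\<exists>g. \<forall>i \<in> pverts H. \<forall>x \<in> V i. g x = i"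
proof -
  have "i = j" if "i \<in> pverts H" "j \<in> pverts H" "x \<in> V i" "x \<in> V j" for i j x
    using assms that unfolding model_in_def disjoint_family_on_def by blast
  then have "(THE i. i \<in> pverts H \<and> x \<in> V i) = i" if "i \<in> pverts H" "x \<in> V i" for x i
    using that by blast
  then show ?thesis by (intro exI[of _ "\<lambda>x. THE i. i \<in> pverts H \<and> x \<in> V i"]) simp
qed

definition branch_subgraph ::
    "'a pair_pre_digraph \<Rightarrow> 'i pair_pre_digraph \<Rightarrow> ('i \<Rightarrow> 'a set) \<Rightarrow> 'a pair_pre_digraph" where
  "branch_subgraph G H V =
    \<lparr>pverts = (\<Union>i \<in> pverts H. V i),
     parcs = {(x, y) \<in> parcs G. \<exists>i \<in> pverts H. \<exists>j \<in> pverts H.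
       x \<in> V i \<and> y \<in> V j \<and> (i = j \<or> (i, j) \<in> parcs H)}\<rparr>"

lemma pair_graph_branch_subgraph:
  assumes "pair_graph G" "pair_graph H" "model_in G H V"
  shows "pair_graph (branch_subgraph G H V)"
proof (rule pair_graphI)
  have "(\<Union>i \<in> pverts H. V i) \<subseteq> pverts G" using model_inD(1)[OF assms(3)] by blast
  then show "finite (pverts (branch_subgraph G H V))"
    using finite_subset[OF _ pair_graph_finite[OF assms(1)]] by (simp add: branch_subgraph_def)
  show "sym (parcs (branch_subgraph G H V))"
    using pair_graph_arcsD(4)[OF assms(1)] pair_graph_arcsD(4)[OF assms(2)]
    unfolding branch_subgraph_def sym_def by simp blast
  show "irrefl (parcs (branch_subgraph G H V))"
    using pair_graph_arcsD(3)[OF assms(1)] by (auto simp: branch_subgraph_def irrefl_def)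
qed (auto simp: branch_subgraph_def)

lemma quotient_graph_branch_subgraph:
  assumes "pair_graph H" "model_in G H V"
    and g: "\<And>i x. i \<in> pverts H \<Longrightarrow> x \<in> V i \<Longrightarrow> g x = i"
  shows "quotient_graph g (branch_subgraph G H V) = H"
proof (rule pair_pre_digraph.equality)
  have "g ` V i = {i}" if "i \<in> pverts H" for i
    using model_inD(2)[OF assms(2) that] g[OF that] by auto
  then show "pverts (quotient_graph g (branch_subgraph G H V)) = pverts H"
    by (simp add: branch_subgraph_def image_UN)
  show "parcs (quotient_graph g (branch_subgraph G H V)) = parcs H"
  proof (intro subset_antisym subrelI)
    fix i j assume "(i, j) \<in> parcs (quotient_graph g (branch_subgraph G H V))"
    then show "(i, j) \<in> parcs H"
      using g by (auto simp: branch_subgraph_def elim!: quotient_graph_arcE)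
  next
    fix i j assume ij: "(i, j) \<in> parcs H"
    note D = pair_graph_arcsD[OF assms(1) ij]
    obtain x y where xy: "x \<in> V i" "y \<in> V j" "(x, y) \<in> parcs G"
      using assms(2) ij by (auto simp: model_in_def touches_def)
    then have "(x, y) \<in> parcs (branch_subgraph G H V)"
      using ij D(1,2) by (auto simp: branch_subgraph_def)
    then show "(i, j) \<in> parcs (quotient_graph g (branch_subgraph G H V))"
      using quotient_graph_arcI[of x y _ g] g[OF D(1) xy(1)] g[OF D(2) xy(2)] D(3) by simp
  qed
qed simp

lemma minor_of_model:
  assumes G: "pair_graph G" and H: "pair_graph H" and model: "model_in G H V"
  shows "minor_of H G"
proof -
  let ?S = "branch_subgraph G H V"
  obtain g where g: "\<And>i x. i \<in> pverts H \<Longrightarrow> x \<in> V i \<Longrightarrow> g x = i"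
    using model_in_index_exists[OF model] by blast
  have S: "pair_graph ?S" by (rule pair_graph_branch_subgraph[OF G H model])
  have "connected_on (parcs ?S) {x \<in> pverts ?S. g x = l}" for l
  proof (cases "l \<in> pverts H")
    case True
    then have "{x \<in> pverts ?S. g x = l} = id ` V l" using g by (auto simp: branch_subgraph_def)
    moreover have "connected_on (parcs ?S) (id ` V l)"
      by (rule connected_on_image[OF model_inD(3)[OF model True]])
        (use True in \<open>auto simp: branch_subgraph_def\<close>)
    ultimately show ?thesis by simp
  next
    case False
    then have "{x \<in> pverts ?S. g x = l} = {}" using g by (auto simp: branch_subgraph_def)
    then show ?thesis unfolding connected_on_def by blast
  qed
  from contracts_to_quotient_graph[OF S this] obtain M where
    "contracts_to\<^sup>*\<^sup>* ?S M" "digraph_iso (with_proj H) (with_proj M)"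
    using quotient_graph_branch_subgraph[OF H model g] by auto
  moreover have "subgraph (with_proj ?S) (with_proj G)"
    by (rule subgraph_with_projI[OF S G])
      (use model_inD(1)[OF model] in \<open>auto simp: branch_subgraph_def\<close>)
  ultimately show ?thesis unfolding minor_of_def using S by blast
qed

definition clique_graph :: "'a set \<Rightarrow> 'a pair_pre_digraph" where
  "clique_graph A = \<lparr>pverts = A, parcs = {(u, v). u \<in> A \<and> v \<in> A \<and> u \<noteq> v}\<rparr>"

lemma pair_graph_clique_graph: "finite A \<Longrightarrow> pair_graph (clique_graph A)"
  by (rule pair_graphI) (auto simp: clique_graph_def sym_def irrefl_def)

lemma model_in_clique_graph_iff:
  "model_in G (clique_graph K) V \<longleftrightarrow>
    (\<forall>i \<in> K. V i \<subseteq> pverts G \<and> V i \<noteq> {} \<and> connected_on (parcs G) (V i)) \<and>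
    (\<forall>i \<in> K. \<forall>j \<in> K. i \<noteq> j \<longrightarrow> V i \<inter> V j = {} \<and> touches (parcs G) (V i) (V j))"
  unfolding model_in_def clique_graph_def disjoint_family_on_def by simp blast

lemma model_in_clique_graph_subset:
  "model_in G (clique_graph K) V \<Longrightarrow> L \<subseteq> K \<Longrightarrow> model_in G (clique_graph L) V"
  unfolding model_in_clique_graph_iff by blast

lemma model_in_clique_graph_insert:
  assumes "sym (parcs G)" "model_in G (clique_graph K) V" "n \<notin> K"
    and "B \<subseteq> pverts G" "B \<noteq> {}" "connected_on (parcs G) B"
    and "\<And>i. i \<in> K \<Longrightarrow> B \<inter> V i = {} \<and> touches (parcs G) B (V i)"
  shows "model_in G (clique_graph (insert n K)) (V(n := B))"
proof -
  have "i \<noteq> n" "V i \<inter> B = {} \<and> touches (parcs G) (V i) B" if "i \<in> K" for i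
    using assms(7)[OF that] touches_sym[OF assms(1)] assms(3) that by auto
  then show ?thesis using assms(2-7) unfolding model_in_clique_graph_iff by simp
qed

definition Kstar_graph :: "'a set \<Rightarrow> 'a set \<Rightarrow> 'a pair_pre_digraph" where
  "Kstar_graph A B =
    \<lparr>pverts = A \<union> B, parcs = {(u, v). u \<in> A \<and> v \<in> A \<and> u \<noteq> v} \<union> A \<times> B \<union> B \<times> A\<rparr>"

lemma pair_graph_Kstar_graph:
  "finite A \<Longrightarrow> finite B \<Longrightarrow> A \<inter> B = {} \<Longrightarrow> pair_graph (Kstar_graph A B)"
  by (rule pair_graphI) (auto simp: Kstar_graph_def sym_def irrefl_def)

lemma model_in_Kstar_graph:
  assumes "sym (parcs G)" "model_in G (clique_graph A) V" "A \<inter> B = {}"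
    and "\<And>i. i \<in> B \<Longrightarrow> U i \<subseteq> pverts G \<and> U i \<noteq> {} \<and> connected_on (parcs G) (U i)"
    and "disjoint_family_on U B"
    and U_touches_V: "\<And>i j. i \<in> B \<Longrightarrow> j \<in> A \<Longrightarrow> U i \<inter> V j = {} \<and> touches (parcs G) (U i) (V j)"
  shows "model_in G (Kstar_graph A B) (\<lambda>i. if i \<in> A then V i else U i)"
proof -
  let ?b = "\<lambda>i. if i \<in> A then V i else U i"
  have clique_V: "V i \<inter> V j = {}" "touches (parcs G) (V i) (V j)" if "i \<in> A" "j \<in> A" "i \<noteq> j" for i j
    using assms(2) that by (simp_all add: model_in_clique_graph_iff)
  have disjoint_U: "U i \<inter> U j = {}" if "i \<in> B" "j \<in> B" "i \<noteq> j" for i j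
    using assms(5) that by (simp add: disjoint_family_on_def)
  have V_touches_U: "V j \<inter> U i = {} \<and> touches (parcs G) (V j) (U i)" if "i \<in> B" "j \<in> A" for i j
    using U_touches_V[OF that] touches_sym[OF assms(1)] by blast
  show ?thesis
    unfolding model_in_def
  proof (intro conjI)
    show "\<forall>i \<in> pverts (Kstar_graph A B).
        ?b i \<subseteq> pverts G \<and> ?b i \<noteq> {} \<and> connected_on (parcs G) (?b i)"
      using assms(2,4) by (auto simp: Kstar_graph_def model_in_clique_graph_iff)
    have "?b i \<inter> ?b j = {}" if "i \<in> A \<union> B" "j \<in> A \<union> B" "i \<noteq> j" for i j
      using that clique_V(1)[of i j] disjoint_U[of i j] U_touches_V[of i j] V_touches_U[of j i]
      by (cases "i \<in> A"; cases "j \<in> A") simp_all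
    then show "disjoint_family_on ?b (pverts (Kstar_graph A B))"
      unfolding disjoint_family_on_def by (simp only: Kstar_graph_def pair_pre_digraph.simps) blast
    have "touches (parcs G) (?b i) (?b j)" if "(i, j) \<in> parcs (Kstar_graph A B)" for i j
      using that assms(3) clique_V(2)[of i j] U_touches_V[of i j] V_touches_U[of j i]
      by (auto simp: Kstar_graph_def)
    then show "\<forall>(i, j) \<in> parcs (Kstar_graph A B). touches (parcs G) (?b i) (?b j)" by blast
  qed
qed

lemma not_Kstar_minor_free:
  fixes A :: "nat set"
  assumes G: "pair_graph G" and "finite A" and model: "model_in G (clique_graph A) V"
    and S: "finite \<S>" "disjoint \<S>"
    and conn: "\<And>F. F \<in> \<S> \<Longrightarrow> F \<subseteq> pverts G \<and> F \<noteq> {} \<and> connected_on (parcs G) F"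
    and adj: "\<And>F i. F \<in> \<S> \<Longrightarrow> i \<in> A \<Longrightarrow> F \<inter> V i = {} \<and> touches (parcs G) F (V i)"
  shows "\<not> Kstar_minor_free (card A) (card \<S>) G"
proof -
  obtain B where B: "finite B" "card B = card \<S>" "B \<subseteq> - A"
    using infinite_arbitrarily_large[of "- A" "card \<S>"] \<open>finite A\<close>
    by (auto simp: Compl_eq_Diff_UNIV)
  then have AB: "A \<inter> B = {}" by blast
  obtain U where U: "bij_betw U B \<S>"
    using finite_same_card_bij[OF B(1) S(1) B(2)] by blast
  then have US: "U i \<in> \<S>" if "i \<in> B" for i using that by (auto simp: bij_betw_def)
  have "U i \<inter> U j = {}" if "i \<in> B" "j \<in> B" "i \<noteq> j" for i j
    using pairwiseD[OF S(2) US[OF that(1)] US[OF that(2)]] U that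
    by (auto simp: disjnt_def bij_betw_def dest: inj_onD)
  then have "disjoint_family_on U B" by (simp add: disjoint_family_on_def)
  have K: "pair_graph (Kstar_graph A B)"
    using pair_graph_Kstar_graph \<open>finite A\<close> \<open>finite B\<close> AB by blast
  have "model_in G (Kstar_graph A B) (\<lambda>i. if i \<in> A then V i else U i)"
    by (rule model_in_Kstar_graph[OF pair_graph_sym[OF G] model AB])
      (use US conn adj \<open>disjoint_family_on U B\<close> in auto)
  then have "minor_of (Kstar_graph A B) G" by (rule minor_of_model[OF G K])
  moreover have "Kstar (card A) (card \<S>) (Kstar_graph A B)"
    using K AB B(2) unfolding Kstar_def
    by (intro conjI exI[of _ A] exI[of _ B]) (simp_all add: Kstar_graph_def)
  ultimately show ?thesis unfolding Kstar_minor_free_def by blast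
qed

section \<open>Rooted trees\<close>

lemma finite_has_arg_max:
  fixes f :: "'a \<Rightarrow> 'b :: linorder"
  assumes "finite S" "S \<noteq> {}"
  shows "\<exists>x \<in> S. \<forall>y \<in> S. f y \<le> f x"
proof -
  have "Max (f ` S) \<in> f ` S" using assms by simp
  then obtain x where "x \<in> S" "f x = Max (f ` S)" by auto
  then show ?thesis using assms(1) by (intro bexI[of _ x]) simp_all
qed

locale rooted_tree =
  fixes V :: "'n set" and r :: 'n and par :: "'n \<Rightarrow> 'n" and rk :: "'n \<Rightarrow> nat"
  assumes root_in: "r \<in> V"
    and parent: "\<And>x. x \<in> V \<Longrightarrow> x \<noteq> r \<Longrightarrow> par x \<in> V \<and> rk (par x) < rk x"
begin

definition parent_arcs :: "('n \<times> 'n) set" where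
  "parent_arcs = {(x, par x) | x. x \<in> V \<and> x \<noteq> r}"

definition tree_graph :: "'n pair_pre_digraph" where
  "tree_graph = \<lparr>pverts = V, parcs = parent_arcs \<union> parent_arcs\<inverse>\<rparr>"

lemma pverts_tree_graph [simp]: "pverts tree_graph = V"
  by (simp add: tree_graph_def)

lemma parent_arcs_iff [simp]: "(x, y) \<in> parent_arcs \<longleftrightarrow> x \<in> V \<and> x \<noteq> r \<and> y = par x"
  by (auto simp: parent_arcs_def)

lemma tree_graph_arc_iff:
  "(x, y) \<in> parcs tree_graph \<longleftrightarrow> x \<in> V \<and> x \<noteq> r \<and> y = par x \<or> y \<in> V \<and> y \<noteq> r \<and> x = par y"
  by (auto simp: tree_graph_def)

lemma sym_tree_graph: "sym (parcs tree_graph)"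
  by (simp add: tree_graph_def sym_Un_converse)

lemma pair_graph_tree_graph:
  assumes "finite V"
  shows "pair_graph tree_graph"
proof (rule pair_graphI)
  show "irrefl (parcs tree_graph)"
    using parent by (metis irreflI less_irrefl tree_graph_arc_iff)
qed (use assms parent in \<open>auto simp: tree_graph_arc_iff sym_tree_graph\<close>)

lemma rk_less_if_ancestor:
  assumes "(x, y) \<in> parent_arcs\<^sup>*"
  shows "x = y \<or> rk y < rk x"
  using assms
proof (induction rule: rtrancl_induct)
  case (step y z)
  then have "rk z < rk y" using parent by simp
  then show ?case using step.IH by auto
qed simp

lemma connected_on_if_parent_closed:
  assumes "m \<in> M" "M \<subseteq> V" "\<And>x. x \<in> M \<Longrightarrow> x \<noteq> m \<Longrightarrow> x \<noteq> r \<and> par x \<in> M"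
  shows "connected_on (parcs tree_graph) M"
proof (rule connected_onI_root[OF sym_tree_graph])
  fix x assume "x \<in> M"
  then show "(m, x) \<in> rtrancl_on M (parcs tree_graph)"
  proof (induction "rk x" arbitrary: x rule: less_induct)
    case less
    show ?case
    proof (cases "x = m")
      case False
      then have "x \<noteq> r" "par x \<in> M" using assms(3) less.prems by auto
      moreover have "x \<in> V" using less.prems assms(2) by blast
      moreover have "(par x, x) \<in> parcs tree_graph"
        using calculation by (simp add: tree_graph_arc_iff)
      moreover have "rk (par x) < rk x" using calculation parent by blast
      ultimately show ?thesis using less by (blast intro: rtrancl_on_into_rtrancl_on)
    qed (use assms(1) in simp)
  qed
qed

lemma connected_on_below:
  assumes M: "connected_on (parcs tree_graph) M" "x \<in> M" "(x, y) \<in> parent_arcs\<^sup>*"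
    and y: "y \<notin> M \<or> (\<forall>z \<in> M. rk y \<le> rk z)" and "z \<in> M"
  shows "(z, y) \<in> parent_arcs\<^sup>*"
proof -
  have "M \<subseteq> {z. (z, y) \<in> parent_arcs\<^sup>*}"
  proof (rule connected_on_subsetI[OF M(1)])
    show "M \<inter> {z. (z, y) \<in> parent_arcs\<^sup>*} \<noteq> {}" using M by blast
    fix a b assume a: "a \<in> M" "a \<in> {z. (z, y) \<in> parent_arcs\<^sup>*}" and b: "b \<in> M"
      and ab: "(a, b) \<in> parcs tree_graph"
    show "b \<in> {z. (z, y) \<in> parent_arcs\<^sup>*}"
    proof (cases "(b, a) \<in> parent_arcs")
      case True
      then show ?thesis using a by (simp add: converse_rtrancl_into_rtrancl)
    next
      case False
      then have pa: "a \<in> V" "a \<noteq> r" "b = par a" using ab by (auto simp: tree_graph_arc_iff)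
      then have "rk b < rk a" using parent by blast
      then have "a \<noteq> y" using a b y by auto
      then show ?thesis using a pa(3) by (auto elim: converse_rtranclE)
    qed
  qed
  then show ?thesis using \<open>z \<in> M\<close> by blast
qed

lemma cycle_length_less_3:
  assumes "finite V" "pre_digraph.cycle (with_proj tree_graph) p"
  shows "length p < 3"
proof (rule ccontr)
  assume long: "\<not> length p < 3"
  interpret T: pair_graph tree_graph by (rule pair_graph_tree_graph[OF assms(1)])
  obtain u where u: "T.awalk u p u" "distinct (tl (pawalk_verts u p))" "p \<noteq> []"
    using assms(2) unfolding T.cycle_def by blast
  then have "distinct (map snd p)" using T.awalk_verts_conv'[of u p u] by (simp add: T.awalk_def)
  obtain a where a: "a \<in> set p" and max: "\<And>e. e \<in> set p \<Longrightarrow> rk (snd e) \<le> rk (snd a)"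
    using finite_has_arg_max[of "set p" "rk \<circ> snd"] u(3) by auto
  obtain q q' where p: "p = q @ a # q'" using split_list[OF a] by blast
  have "2 \<le> length (q' @ q)" using long p by simp
  then obtain b m c where bmc: "q' @ q = b # m @ [c]"
    by (metis One_nat_def Suc_1 Suc_le_length_iff append_butlast_last_id list.distinct(1))
  have in_p: "b \<in> set p" "c \<in> set p" using arg_cong[OF bmc, of set] p by auto
  have "T.awalk u q (fst a)" "T.awalk (snd a) q' u" "a \<in> parcs tree_graph"
    using u(1) unfolding p by (auto simp: T.awalk_Cons_iff)
  then have "T.awalk (snd a) (b # m @ [c]) (fst a)" using T.awalk_appendI bmc by metis
  then have "b \<in> parcs tree_graph" "fst b = snd a" "snd c = fst a"
    by (auto simp: T.awalk_simps)
  moreover have "z = par (snd a)"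
    if "(snd a, z) \<in> parcs tree_graph" "rk z \<le> rk (snd a)" for z
    using that parent[of z] by (auto simp: tree_graph_arc_iff)
  ultimately have "snd b = par (snd a)" "snd c = par (snd a)"
    using max[OF in_p(1)] max[OF in_p(2)] \<open>a \<in> parcs tree_graph\<close> symD[OF sym_tree_graph]
    by (metis prod.collapse)+
  moreover have "distinct (map snd (q' @ q))" using \<open>distinct (map snd p)\<close> unfolding p by auto
  ultimately show False unfolding bmc by simp
qed

lemma undirected_tree_tree_graph:
  assumes "finite V"
  shows "undirected_tree tree_graph"
proof -
  have "connected_on (parcs tree_graph) V"
    by (rule connected_on_if_parent_closed[of r]) (use root_in parent in auto)
  then have "connected (with_proj tree_graph)"
    using connected_pair_graph_iff[OF pair_graph_tree_graph[OF assms]] root_in by auto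
  then show ?thesis
    unfolding undirected_tree_def
    using pair_graph_tree_graph[OF assms] cycle_length_less_3[OF assms] by force
qed

end

lemma rooted_tree_insert:
  assumes "rooted_tree V r par rk" "a \<in> V" "z \<notin> V"
  shows "rooted_tree (insert z V) r (par(z := a)) (rk(z := Suc (rk a)))"
    and "parcs (rooted_tree.tree_graph (insert z V) r (par(z := a))) =
      parcs (rooted_tree.tree_graph V r par) \<union> {(a, z), (z, a)}"
proof -
  interpret rooted_tree V r par rk by fact
  show ins: "rooted_tree (insert z V) r (par(z := a)) (rk(z := Suc (rk a)))"
  proof
    fix x assume "x \<in> insert z V" "x \<noteq> r"
    then show "(par(z := a)) x \<in> insert z V \<and>
      (rk(z := Suc (rk a))) ((par(z := a)) x) < (rk(z := Suc (rk a))) x"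
      using assms(2,3) parent[of x] by (cases "x = z") auto
  qed (use root_in in simp)
  have "z \<noteq> r" using root_in assms(3) by blast
  then have "(x, y) \<in> rooted_tree.parent_arcs (insert z V) r (par(z := a)) \<longleftrightarrow>
      (x, y) \<in> insert (z, a) parent_arcs" for x y
    using assms(3) by (cases "x = z") (auto simp: rooted_tree.parent_arcs_iff[OF ins])
  then have "rooted_tree.parent_arcs (insert z V) r (par(z := a)) = insert (z, a) parent_arcs"
    by (intro subset_antisym subrelI) blast+
  then show "parcs (rooted_tree.tree_graph (insert z V) r (par(z := a))) =
      parcs tree_graph \<union> {(a, z), (z, a)}"
    by (auto simp: tree_graph_def rooted_tree.tree_graph_def[OF ins])
qed

lemma cycle_through_outside_vertex:
  assumes T: "pair_graph T" and S: "S \<subseteq> pverts T" "connected_on (parcs T) S"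
    and ab: "a \<in> S" "b \<in> S" "a \<noteq> b" and z: "z \<notin> S" "(z, a) \<in> parcs T" "(z, b) \<in> parcs T"
  shows "\<exists>p. pre_digraph.cycle (with_proj T) p \<and> 3 \<le> length p"
proof -
  let ?H = "\<lparr>pverts = S, parcs = Restr (parcs T) S\<rparr>"
  interpret T: pair_graph T by fact
  interpret H: pair_wf_digraph ?H by unfold_locales auto
  have "a \<rightarrow>\<^sup>*\<^bsub>with_proj ?H\<^esub> b"
    using S(2) ab by (simp add: reachable_def connected_on_def rtrancl_on_Restr)
  then obtain q where q: "H.apath a q b" using H.reachable_apath by blast
  then have "H.awalk a q b" "distinct (pawalk_verts a q)" by (auto simp: H.apath_def)
  then have qS: "set (pawalk_verts a q) \<subseteq> S" and "set q \<subseteq> Restr (parcs T) S" "pcas a q b"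
    unfolding H.awalk_conv by simp_all
  then have walk: "T.awalk a q b" using S(1) ab(1) by (auto simp: T.awalk_def)
  have "q \<noteq> []" using q ab(3) by (auto simp: H.apath_Nil_iff)
  let ?p = "(z, a) # q @ [(b, z)]"
  have "T.awalk z ?p z"
    using walk z pair_graph_arcsD[OF T z(3)] by (auto simp: T.awalk_simps)
  moreover have "tl (pawalk_verts z ?p) = pawalk_verts a q @ [z]"
    using T.awalk_verts_append[of a q "[(b, z)]" z] walk pair_graph_arcsD[OF T z(3)]
    by (auto simp: T.awalk_simps)
  then have "distinct (tl (pawalk_verts z ?p))" using \<open>distinct (pawalk_verts a q)\<close> qS z(1) by auto
  ultimately have "T.cycle ?p" unfolding T.cycle_def by blast
  moreover have "3 \<le> length ?p" using \<open>q \<noteq> []\<close> by (cases q) auto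
  ultimately show ?thesis by blast
qed

lemma rooted_tree_of_undirected_tree:
  assumes "undirected_tree T"
  obtains r par rk where "rooted_tree (pverts T) r par rk"
    and "T = rooted_tree.tree_graph (pverts T) r par"
proof -
  let ?E = "parcs T"
  have T: "pair_graph T" and "pverts T \<noteq> {}" "connected_on ?E (pverts T)"
    and acyclic: "\<not> (\<exists>p. pre_digraph.cycle (with_proj T) p \<and> 3 \<le> length p)"
    using assms connected_pair_graph_iff[of T] unfolding undirected_tree_def by auto
  let ?P = "\<lambda>Z. \<exists>r par rk. rooted_tree Z r par rk \<and>
    parcs (rooted_tree.tree_graph Z r par) = ?E \<inter> Z \<times> Z"
  obtain r where "r \<in> pverts T" using \<open>pverts T \<noteq> {}\<close> by blast
  have "?P (pverts T)"
    using pair_graph_sym[OF T] pair_graph_finite[OF T] \<open>connected_on ?E (pverts T)\<close> \<open>r \<in> pverts T\<close>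
  proof (induction rule: finite_connected_induct)
    case singleton
    interpret rooted_tree "{r}" r id "\<lambda>_. 0" by standard auto
    have "parcs tree_graph = ?E \<inter> {r} \<times> {r}"
      using pair_graph_arcsD(3)[OF T] by (auto simp: tree_graph_arc_iff)
    then show ?case using rooted_tree_axioms by blast
  next
    case (insert Z a z)
    then obtain r par rk where tree: "rooted_tree Z r par rk"
      and arcs: "parcs (rooted_tree.tree_graph Z r par) = ?E \<inter> Z \<times> Z" by blast
    have "b = a" if "b \<in> Z" "(z, b) \<in> ?E" for b
      using cycle_through_outside_vertex[OF T, of Z a b z] insert.hyps that acyclic
        pair_graph_arcsD(4)[OF T] by blast
    then have "?E \<inter> insert z Z \<times> insert z Z = (?E \<inter> Z \<times> Z) \<union> {(a, z), (z, a)}"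
      using insert.hyps pair_graph_arcsD(3,4)[OF T] by blast
    then show ?case using rooted_tree_insert[OF tree, of a z] insert.hyps arcs by blast
  qed
  then obtain r par rk where tree: "rooted_tree (pverts T) r par rk"
    and "parcs (rooted_tree.tree_graph (pverts T) r par) = ?E \<inter> pverts T \<times> pverts T" by blast
  moreover have "?E \<inter> pverts T \<times> pverts T = ?E" using pair_graph_arcsD(1,2)[OF T] by auto
  ultimately have "T = rooted_tree.tree_graph (pverts T) r par"
    by (intro pair_pre_digraph.equality) (simp_all add: rooted_tree.pverts_tree_graph)
  then show thesis using that tree by blast
qed

section \<open>Packing and hitting connected sets\<close>

definition nodes_meeting :: "'n pair_pre_digraph \<Rightarrow> ('n \<Rightarrow> 'a set) \<Rightarrow> 'a set \<Rightarrow> 'n set" where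
  "nodes_meeting T W F = {x \<in> pverts T. W x \<inter> F \<noteq> {}}"

lemma tree_decompositionD:
  assumes "tree_decomposition G T W"
  shows "undirected_tree T" "\<And>v w. (v, w) \<in> parcs G \<Longrightarrow> \<exists>x \<in> pverts T. v \<in> W x \<and> w \<in> W x"
    and "\<And>v. v \<in> pverts G \<Longrightarrow>
      nodes_meeting T W {v} \<noteq> {} \<and> connected_on (parcs T) (nodes_meeting T W {v})"
proof -
  show "undirected_tree T" "\<And>v w. (v, w) \<in> parcs G \<Longrightarrow> \<exists>x \<in> pverts T. v \<in> W x \<and> w \<in> W x"
    using assms by (auto simp: tree_decomposition_def)
  fix v assume "v \<in> pverts G"
  then have "connected (with_proj T \<restriction> nodes_meeting T W {v})"
    using assms by (simp add: tree_decomposition_def nodes_meeting_def)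
  moreover have "sym (parcs T)"
    using assms pair_graph_sym by (auto simp: tree_decomposition_def undirected_tree_def)
  ultimately show "nodes_meeting T W {v} \<noteq> {} \<and> connected_on (parcs T) (nodes_meeting T W {v})"
    by (simp add: connected_induce_iff)
qed

lemma connected_on_nodes_meeting:
  assumes td: "tree_decomposition G T W" and F: "F \<subseteq> pverts G" "connected_on (parcs G) F"
  shows "connected_on (parcs T) (nodes_meeting T W F)"
proof -
  have "connected_on (parcs T) (\<Union>v \<in> F. nodes_meeting T W {v})"
  proof (rule connected_on_UN[OF F(2)])
    show "connected_on (parcs T) (nodes_meeting T W {v})" if "v \<in> F" for v
      using tree_decompositionD(3)[OF td] that F(1) by blast
    show "nodes_meeting T W {v} \<inter> nodes_meeting T W {w} \<noteq> {}" if "(v, w) \<in> parcs G" for v w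
      using tree_decompositionD(2)[OF td that] by (auto simp: nodes_meeting_def)
  qed
  moreover have "(\<Union>v \<in> F. nodes_meeting T W {v}) = nodes_meeting T W F"
    by (auto simp: nodes_meeting_def)
  ultimately show ?thesis by simp
qed

definition connected_upset :: "('a \<times> 'a) set \<Rightarrow> 'a set \<Rightarrow> 'a set set \<Rightarrow> bool" where
  "connected_upset E D \<F> \<longleftrightarrow>
    (\<forall>F \<in> \<F>. F \<subseteq> D \<and> F \<noteq> {} \<and> connected_on E F) \<and>
    (\<forall>F \<in> \<F>. \<forall>F'. F \<subseteq> F' \<and> F' \<subseteq> D \<and> connected_on E F' \<longrightarrow> F' \<in> \<F>)"

lemma connected_upsetD:
  assumes "connected_upset E D \<F>" "F \<in> \<F>"
  shows "F \<subseteq> D" "F \<noteq> {}" "connected_on E F"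
    and "\<And>F'. F \<subseteq> F' \<Longrightarrow> F' \<subseteq> D \<Longrightarrow> connected_on E F' \<Longrightarrow> F' \<in> \<F>"
  using assms unfolding connected_upset_def by blast+

lemma connected_upset_avoiding:
  assumes "connected_upset E D \<F>"
  shows "connected_upset E (D - Q) {F \<in> \<F>. F \<inter> Q = {}}"
  unfolding connected_upset_def
proof (intro conjI ballI allI impI)
  note up = connected_upsetD[OF assms]
  fix F assume "F \<in> {F \<in> \<F>. F \<inter> Q = {}}"
  then have F: "F \<in> \<F>" "F \<inter> Q = {}" by auto
  show "F \<subseteq> D - Q" "F \<noteq> {}" "connected_on E F" using up(1-3)[OF F(1)] F(2) by auto
  fix F' assume "F \<subseteq> F' \<and> F' \<subseteq> D - Q \<and> connected_on E F'"
  then show "F' \<in> {F \<in> \<F>. F \<inter> Q = {}}" using up(4)[OF F(1), of F'] by auto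
qed

locale rooted_tree_decomposition = rooted_tree V r par rk
  for V :: "'n set" and r par rk +
  fixes G :: "'a pair_pre_digraph" and W :: "'n \<Rightarrow> 'a set"
  assumes pair_graph: "pair_graph G" and decomposition: "tree_decomposition G tree_graph W"
begin

abbreviation nodes :: "'a set \<Rightarrow> 'n set" where
  "nodes \<equiv> nodes_meeting tree_graph W"

definition top_node :: "'a set \<Rightarrow> 'n \<Rightarrow> bool" where
  "top_node F y \<longleftrightarrow> y \<in> nodes F \<and> (\<forall>x \<in> nodes F. rk y \<le> rk x)"

definition below :: "'a set \<Rightarrow> 'n \<Rightarrow> 'a set" where
  "below D y = {v \<in> D. \<exists>x \<in> nodes {v}. (x, y) \<in> parent_arcs\<^sup>*}"

lemma nodes_eq_UN: "nodes F = (\<Union>v \<in> F. nodes {v})"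
  by (auto simp: nodes_meeting_def)

lemma finite_top_nodes: "finite {y. \<exists>F \<in> \<F>. top_node F y}"
proof (rule finite_subset)
  show "finite V"
    using tree_decompositionD(1)[OF decomposition] pair_graph_finite[of tree_graph]
    by (simp add: undirected_tree_def)
qed (auto simp: top_node_def nodes_meeting_def)

lemma top_node_exists:
  assumes "F \<subseteq> pverts G" "F \<noteq> {}"
  shows "\<exists>y. top_node F y"
proof -
  obtain v where "v \<in> F" "v \<in> pverts G" using assms by blast
  then obtain x where "x \<in> nodes F"
    using tree_decompositionD(3)[OF decomposition] nodes_eq_UN by blast
  then show ?thesis using ex_has_least_nat[of "\<lambda>x. x \<in> nodes F" x rk] by (auto simp: top_node_def)
qed

lemma subset_below_top_node:
  assumes "connected_on (parcs G) F" "F \<subseteq> D" "D \<subseteq> pverts G" "top_node F y"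
  shows "F \<subseteq> below D y"
proof
  fix v assume "v \<in> F"
  then obtain x where "x \<in> nodes {v}"
    using tree_decompositionD(3)[OF decomposition, of v] assms(2,3) by blast
  moreover have "(x, y) \<in> parent_arcs\<^sup>*"
  proof (rule connected_on_below[of "nodes F" y])
    show "connected_on (parcs tree_graph) (nodes F)"
      using connected_on_nodes_meeting[OF decomposition] assms(1-3) by blast
    show "x \<in> nodes F" using calculation \<open>v \<in> F\<close> nodes_eq_UN by blast
  qed (use assms(4) in \<open>auto simp: top_node_def\<close>)
  ultimately show "v \<in> below D y" using \<open>v \<in> F\<close> assms(2) by (auto simp: below_def)
qed

lemma nodes_below_avoided_bag:
  assumes "D \<subseteq> pverts G" "v \<in> below D y" "v \<notin> W y" "x \<in> nodes {v}"
  shows "(x, y) \<in> parent_arcs\<^sup>*"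
proof -
  have "connected_on (parcs tree_graph) (nodes {v})"
    using tree_decompositionD(3)[OF decomposition] assms(1,2) by (auto simp: below_def)
  moreover have "y \<notin> nodes {v}" using assms(3) by (simp add: nodes_meeting_def)
  ultimately show ?thesis using connected_on_below assms(2,4) unfolding below_def by blast
qed

lemma subset_reach_below_if_avoids_bag:
  assumes F: "connected_on (parcs G) F" "F \<subseteq> D" "D \<subseteq> pverts G"
    and Q: "Q = reach (parcs G) (below D y) A" "F \<inter> Q \<noteq> {}" "F \<inter> Q \<inter> W y = {}"
  shows "F \<subseteq> Q"
proof (rule connected_on_subsetI[OF F(1) Q(2)])
  fix a b assume ab: "a \<in> F" "a \<in> Q" "b \<in> F" "(a, b) \<in> parcs G"
  then obtain x where x: "x \<in> nodes {a}" "x \<in> nodes {b}"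
    using tree_decompositionD(2)[OF decomposition ab(4)] by (auto simp: nodes_meeting_def)
  have "a \<in> below D y" using reach_subset ab(2) Q(1) by fast
  then have "(x, y) \<in> parent_arcs\<^sup>*"
    using nodes_below_avoided_bag[OF F(3) _ _ x(1)] ab(1,2) Q(3) by blast
  then have "b \<in> below D y" using x(2) ab(3) F(2) by (auto simp: below_def)
  then show "b \<in> Q" using reach_closed[of a _ _ A b] ab(2,4) Q(1) by fast
qed

text \<open>
  Take a member whose topmost tree node \<open>y\<close> is as deep as possible, and let \<open>Q\<close> be its component in
  the part of \<open>D\<close> met by the bags below \<open>y\<close>. A member that meets \<open>Q\<close> but avoids \<open>W y\<close> in \<open>Q\<close> cannot
  leave \<open>Q\<close>, so its topmost node is strictly below \<open>y\<close>.
\<close>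

lemma bag_hitting_neighbours_rooted:
  assumes "D \<subseteq> pverts G" and up: "connected_upset (parcs G) D \<F>" and "\<F> \<noteq> {}"
  shows "\<exists>Q \<in> \<F>. \<exists>y \<in> V. \<forall>F \<in> \<F>. F \<inter> Q \<noteq> {} \<longrightarrow> F \<inter> Q \<inter> W y \<noteq> {}"
proof -
  let ?E = "parcs G"
  note sub = connected_upsetD(1)[OF up] and ne = connected_upsetD(2)[OF up]
    and conn = connected_upsetD(3)[OF up]
  have top: "\<exists>y. top_node F y" if "F \<in> \<F>" for F
    using top_node_exists sub[OF that] ne[OF that] \<open>D \<subseteq> pverts G\<close> by blast
  let ?tops = "{y. \<exists>F \<in> \<F>. top_node F y}"
  have "?tops \<noteq> {}" using top \<open>\<F> \<noteq> {}\<close> by blast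
  then obtain y where "y \<in> ?tops" and deepest: "\<forall>y' \<in> ?tops. rk y' \<le> rk y"
    using finite_has_arg_max[OF finite_top_nodes] by blast
  then obtain F\<^sub>0 where F\<^sub>0: "F\<^sub>0 \<in> \<F>" "top_node F\<^sub>0 y" by blast
  define Q where "Q = reach ?E (below D y) F\<^sub>0"
  have "F\<^sub>0 \<subseteq> below D y"
    using subset_below_top_node[OF conn[OF F\<^sub>0(1)] sub[OF F\<^sub>0(1)] assms(1) F\<^sub>0(2)] .
  then have "F\<^sub>0 \<subseteq> Q" "connected_on ?E Q"
    unfolding Q_def
    using subset_reach connected_on_reach[OF pair_graph_sym[OF pair_graph] conn[OF F\<^sub>0(1)]]
    by blast+
  moreover have Q_below: "Q \<subseteq> below D y" unfolding Q_def by (rule reach_subset)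
  moreover have "below D y \<subseteq> D" by (auto simp: below_def)
  ultimately have "Q \<in> \<F>" using connected_upsetD(4)[OF up F\<^sub>0(1), of Q] by blast
  moreover have "F \<inter> Q \<inter> W y \<noteq> {}" if F: "F \<in> \<F>" "F \<inter> Q \<noteq> {}" for F
  proof
    assume avoid: "F \<inter> Q \<inter> W y = {}"
    have "F \<subseteq> Q"
      using subset_reach_below_if_avoids_bag[OF conn[OF F(1)] sub[OF F(1)] assms(1) Q_def]
        F(2) avoid by blast
    obtain y' where y': "top_node F y'" using top[OF F(1)] by blast
    then obtain v where v: "v \<in> F" "y' \<in> nodes {v}" by (auto simp: top_node_def nodes_meeting_def)
    have "v \<in> below D y" "v \<notin> W y" using v(1) \<open>F \<subseteq> Q\<close> Q_below avoid by blast+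
    then have "(y', y) \<in> parent_arcs\<^sup>*" by (rule nodes_below_avoided_bag[OF assms(1) _ _ v(2)])
    moreover have "y' \<noteq> y" using v(2) \<open>v \<notin> W y\<close> by (auto simp: nodes_meeting_def)
    ultimately have "rk y < rk y'" using rk_less_if_ancestor by blast
    moreover have "y' \<in> ?tops" using y' F(1) by blast
    ultimately show False using deepest by fastforce
  qed
  moreover have "y \<in> V" using F\<^sub>0(2) by (simp add: top_node_def nodes_meeting_def)
  ultimately show ?thesis by blast
qed

end

lemma bag_hitting_neighbours:
  assumes "pair_graph G" "tree_decomposition G T W" "D \<subseteq> pverts G"
    and "connected_upset (parcs G) D \<F>" "\<F> \<noteq> {}"
  shows "\<exists>Q \<in> \<F>. \<exists>y \<in> pverts T. \<forall>F \<in> \<F>. F \<inter> Q \<noteq> {} \<longrightarrow> F \<inter> Q \<inter> W y \<noteq> {}"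
proof -
  obtain r par rk where "rooted_tree (pverts T) r par rk"
    and "T = rooted_tree.tree_graph (pverts T) r par"
    using rooted_tree_of_undirected_tree[OF tree_decompositionD(1)[OF assms(2)]] .
  then have "rooted_tree_decomposition (pverts T) r par rk G W"
    using assms(1,2)
    by (simp add: rooted_tree_decomposition_def rooted_tree_decomposition_axioms_def)
  from rooted_tree_decomposition.bag_hitting_neighbours_rooted[OF this assms(3-5)] show ?thesis .
qed

lemma disjoint_subfamily_insert:
  assumes "\<S> \<subseteq> {F \<in> \<F>. F \<inter> Q = {}}" "finite \<S>" "disjoint \<S>" "Q \<in> \<F>" "Q \<noteq> {}"
  shows "insert Q \<S> \<subseteq> \<F>" "card (insert Q \<S>) = Suc (card \<S>)" "disjoint (insert Q \<S>)"
proof -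
  have "Q \<notin> \<S>" using assms(1,5) by blast
  then show "card (insert Q \<S>) = Suc (card \<S>)" using assms(2) by simp
qed (use assms in \<open>auto simp: pairwise_insert disjnt_def\<close>)

lemma hitting_bags_insert:
  assumes "\<forall>F \<in> {F \<in> \<F>. F \<inter> Q = {}}. F \<inter> \<Union>(W ` Y) \<noteq> {}"
    and "\<forall>F \<in> \<F>. F \<inter> Q \<noteq> {} \<longrightarrow> F \<inter> Q \<inter> W y \<noteq> {}"
  shows "\<forall>F \<in> \<F>. F \<inter> \<Union>(W ` insert y Y) \<noteq> {}"
proof
  fix F assume "F \<in> \<F>"
  show "F \<inter> \<Union>(W ` insert y Y) \<noteq> {}"
  proof (cases "F \<inter> Q = {}")
    case True
    then have "F \<inter> \<Union>(W ` Y) \<noteq> {}" using assms(1) \<open>F \<in> \<F>\<close> by simp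
    then show ?thesis by auto
  next
    case False
    then have "F \<inter> Q \<inter> W y \<noteq> {}" using assms(2) \<open>F \<in> \<F>\<close> by blast
    then show ?thesis by auto
  qed
qed

lemma disjoint_subfamily_or_hitting_bags:
  assumes G: "pair_graph G" and td: "tree_decomposition G T W" and "D \<subseteq> pverts G"
    and "connected_upset (parcs G) D \<F>"
  shows "(\<exists>\<S> \<subseteq> \<F>. finite \<S> \<and> card \<S> = k \<and> disjoint \<S>) \<or>
    (\<exists>Y \<subseteq> pverts T. finite Y \<and> card Y < k \<and> (\<forall>F \<in> \<F>. F \<inter> \<Union>(W ` Y) \<noteq> {}))"
  using assms(3,4)
proof (induction k arbitrary: D \<F>)
  case 0
  show ?case by (intro disjI1 exI[of _ "{}"]) simp
next
  case (Suc k)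
  note up = Suc.prems(2)
  show ?case
  proof (cases "\<F> = {}")
    case True
    then show ?thesis by (intro disjI2 exI[of _ "{}"]) simp
  next
    case False
    obtain Q y where Q: "Q \<in> \<F>" "y \<in> pverts T"
      and hit: "\<forall>F \<in> \<F>. F \<inter> Q \<noteq> {} \<longrightarrow> F \<inter> Q \<inter> W y \<noteq> {}"
      using bag_hitting_neighbours[OF G td Suc.prems False] by blast
    let ?\<F>' = "{F \<in> \<F>. F \<inter> Q = {}}"
    have "D - Q \<subseteq> pverts G" using Suc.prems(1) by blast
    from Suc.IH[OF this connected_upset_avoiding[OF up]] consider
      (packing) \<S> where "\<S> \<subseteq> ?\<F>'" "finite \<S>" "card \<S> = k" "disjoint \<S>"
      | (hitting) Y where "Y \<subseteq> pverts T" "finite Y" "card Y < k" "\<forall>F \<in> ?\<F>'. F \<inter> \<Union>(W ` Y) \<noteq> {}"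
      by blast
    then show ?thesis
    proof cases
      case packing
      then show ?thesis
        using disjoint_subfamily_insert[OF packing(1,2,4) Q(1) connected_upsetD(2)[OF up Q(1)]]
        by (intro disjI1 exI[of _ "insert Q \<S>"]) simp
    next
      case hitting
      moreover have "card (insert y Y) < Suc k" using hitting(2,3) by (simp add: card_insert_if)
      ultimately show ?thesis
        using hitting_bags_insert[OF hitting(4) hit] Q(2)
        by (intro disjI2 exI[of _ "insert y Y"]) simp
    qed
  qed
qed

lemma minimal_hitting_set:
  assumes "finite X" "\<And>F. F \<in> \<F> \<Longrightarrow> F \<inter> X \<noteq> {}"
  shows "\<exists>X' \<subseteq> X. (\<forall>F \<in> \<F>. F \<inter> X' \<noteq> {}) \<and> (\<forall>x \<in> X'. \<exists>F \<in> \<F>. F \<inter> X' = {x})"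
proof -
  let ?\<H> = "{X'. X' \<subseteq> X \<and> (\<forall>F \<in> \<F>. F \<inter> X' \<noteq> {})}"
  have "finite ?\<H>" "X \<in> ?\<H>" using assms by auto
  from finite_has_minimal2[OF this] obtain X' where
    X': "X' \<in> ?\<H>" and min: "\<forall>X'' \<in> ?\<H>. X'' \<subseteq> X' \<longrightarrow> X' = X''" by (elim bexE conjE)
  have "\<exists>F \<in> \<F>. F \<inter> X' = {x}" if "x \<in> X'" for x
  proof -
    have "X' - {x} \<notin> ?\<H>" using bspec[OF min, of "X' - {x}"] that by blast
    then obtain F where "F \<in> \<F>" "F \<inter> (X' - {x}) = {}" using X' by blast
    moreover have "F \<inter> X' \<noteq> {}" using X' calculation(1) by blast
    ultimately show ?thesis by blast
  qed
  then show ?thesis using X' by blast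
qed

section \<open>Forests of cliques\<close>

text \<open>
  A node \<open>x\<close> has the bag \<open>insert x (up x)\<close>, where \<open>up x\<close> is part of the bag of the parent. The
  parents of the roots of the forest are the outer node \<open>q\<close>, whose bag contains \<open>K\<close>. That no \<open>s\<close>-set
  occurs twice as \<open>up x\<close> makes the decomposition into these bags \<open>s\<close>-simple.
\<close>

definition attached_forest ::
    "nat \<Rightarrow> 'i set \<Rightarrow> 'i \<Rightarrow> 'i set \<Rightarrow> ('i \<Rightarrow> 'i set) \<Rightarrow> ('i \<Rightarrow> 'i) \<Rightarrow> ('i \<Rightarrow> nat) \<Rightarrow> bool" where
  "attached_forest s K q N up par rk \<longleftrightarrow>
    (\<forall>x \<in> N. finite (up x) \<and> card (up x) \<le> s \<and>
      (par x = q \<and> up x \<subseteq> K \<or>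
       par x \<in> N \<and> rk (par x) < rk x \<and> up x \<subseteq> insert (par x) (up (par x)))) \<and>
    inj_on up {x \<in> N. card (up x) = s}"

lemma attached_forestD:
  assumes "attached_forest s K q N up par rk" "x \<in> N"
  shows "finite (up x)" "card (up x) \<le> s"
    and "par x = q \<and> up x \<subseteq> K \<or>
      par x \<in> N \<and> rk (par x) < rk x \<and> up x \<subseteq> insert (par x) (up (par x))"
  using assms unfolding attached_forest_def by blast+

lemma attached_forest_inj:
  assumes "attached_forest s K q N up par rk" "x \<in> N" "y \<in> N" "card (up x) = s" "up x = up y"
  shows "x = y"
proof -
  have "inj_on up {x \<in> N. card (up x) = s}" using assms(1) by (simp add: attached_forest_def)
  then show ?thesis by (rule inj_onD) (use assms(2-5) in simp_all)
qed

lemma attached_forest_up_subset: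
  assumes "attached_forest s K q N up par rk" "x \<in> N"
  shows "up x \<subseteq> K \<union> {y \<in> N. rk y < rk x}"
  using assms(2)
proof (induction "rk x" arbitrary: x rule: less_induct)
  case less
  from attached_forestD(3)[OF assms(1) less.prems] show ?case
  proof
    assume par: "par x \<in> N \<and> rk (par x) < rk x \<and> up x \<subseteq> insert (par x) (up (par x))"
    then have "up (par x) \<subseteq> K \<union> {y \<in> N. rk y < rk (par x)}" using less.hyps by blast
    then show ?thesis using par by fastforce
  qed blast
qed

lemma attached_forests_up_eq:
  assumes forests: "attached_forest s K q N up par rk" "attached_forest s L q' M up' par' rk'"
    and KL: "finite K" "card K \<le> s" "finite L" "card L \<le> s"
    and disjoint: "N \<inter> M = {}" "K \<inter> M = {}" "L \<inter> N = {}"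
    and x: "x \<in> N" "y \<in> M" "card (up x) = s" "up x = up' y"
  shows "K = L" "card K = s"
proof -
  have "up x \<subseteq> K \<union> N" "up' y \<subseteq> L \<union> M"
    using attached_forest_up_subset[OF forests(1) x(1)]
      attached_forest_up_subset[OF forests(2) x(2)] by blast+
  then have "up x \<subseteq> K" "up x \<subseteq> L" using disjoint x(4) by blast+
  then have "up x = K" "up x = L" using KL x(3) card_seteq by metis+
  then show "K = L" "card K = s" using x(3) by simp_all
qed

lemma attached_forest_UN:
  assumes forest: "\<And>c. c \<in> I \<Longrightarrow> attached_forest s (K c) q (N c) (up c) (par c) (rk c)"
    and index: "\<And>c x. c \<in> I \<Longrightarrow> x \<in> N c \<Longrightarrow> index x = c"
    and K: "\<And>c. c \<in> I \<Longrightarrow> finite (K c) \<and> card (K c) \<le> s \<and> K c \<subseteq> K' \<and> K c \<inter> (\<Union>c \<in> I. N c) = {}"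
    and inj: "inj_on K {c \<in> I. card (K c) = s}"
  shows "attached_forest s K' q (\<Union>c \<in> I. N c)
    (\<lambda>x. up (index x) x) (\<lambda>x. par (index x) x) (\<lambda>x. rk (index x) x)"
  unfolding attached_forest_def
proof (intro conjI ballI)
  fix x assume "x \<in> (\<Union>c \<in> I. N c)"
  then obtain c where c: "c \<in> I" "x \<in> N c" by blast
  note x = attached_forestD[OF forest[OF c(1)] c(2)] and index_x = index[OF c]
  show "finite (up (index x) x)" "card (up (index x) x) \<le> s" using x(1,2) index_x by simp_all
  from x(3) show "par (index x) x = q \<and> up (index x) x \<subseteq> K' \<or>
    par (index x) x \<in> (\<Union>c \<in> I. N c) \<and>
    rk (index (par (index x) x)) (par (index x) x) < rk (index x) x \<and>
    up (index x) x \<subseteq> insert (par (index x) x) (up (index (par (index x) x)) (par (index x) x))"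
  proof
    assume "par c x = q \<and> up c x \<subseteq> K c"
    then show ?thesis using K[OF c(1)] index_x by blast
  next
    assume par: "par c x \<in> N c \<and> rk c (par c x) < rk c x \<and>
      up c x \<subseteq> insert (par c x) (up c (par c x))"
    then have "index (par c x) = c" using index c(1) by blast
    then show ?thesis using par c(1) index_x by auto
  qed
next
  show "inj_on (\<lambda>x. up (index x) x) {x \<in> \<Union>c \<in> I. N c. card (up (index x) x) = s}"
  proof (rule inj_onI)
    fix x y assume "x \<in> {x \<in> \<Union>c \<in> I. N c. card (up (index x) x) = s}"
      and "y \<in> {x \<in> \<Union>c \<in> I. N c. card (up (index x) x) = s}"
      and "up (index x) x = up (index y) y"
    then obtain c d where x: "c \<in> I" "x \<in> N c" "card (up c x) = s"
      and y: "d \<in> I" "y \<in> N d" "card (up d y) = s" and eq: "up c x = up d y"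
      using index by auto
    have "c = d"
    proof (rule ccontr)
      assume "c \<noteq> d"
      then have "N c \<inter> N d = {}" using index x(1) y(1) by blast
      moreover have "K c \<inter> N d = {}" "K d \<inter> N c = {}" using K x(1) y(1) by blast+
      ultimately have "K c = K d" "card (K c) = s"
        using attached_forests_up_eq[OF forest[OF x(1)] forest[OF y(1)] _ _ _ _ _ _ _
            x(2) y(2) x(3) eq] K x(1) y(1) by simp_all
      then show False using inj_onD[OF inj, of c d] x(1) y(1) \<open>c \<noteq> d\<close> by simp
    qed
    then show "x = y" using attached_forest_inj[OF forest[OF x(1)]] x y eq by metis
  qed
qed

lemma attached_forest_insert:
  assumes forest: "attached_forest s (insert n K) n N up par rk"
    and K: "finite K" "card K \<le> s" and "n \<notin> N"
    and fresh: "\<And>x. x \<in> N \<Longrightarrow> card (up x) = s \<Longrightarrow> up x \<noteq> K"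
  shows "attached_forest s K q (insert n N) (up(n := K)) (par(n := q))
    (\<lambda>x. if x = n then 0 else Suc (rk x))"
  unfolding attached_forest_def
proof (intro conjI ballI)
  fix x assume x: "x \<in> insert n N"
  let ?up = "up(n := K)" and ?par = "par(n := q)" and ?rk = "\<lambda>x. if x = n then 0 else Suc (rk x)"
  show "finite (?up x)" "card (?up x) \<le> s"
    using x K attached_forestD(1,2)[OF forest] by auto
  show "?par x = q \<and> ?up x \<subseteq> K \<or>
    ?par x \<in> insert n N \<and> ?rk (?par x) < ?rk x \<and> ?up x \<subseteq> insert (?par x) (?up (?par x))"
  proof (cases "x = n")
    case False
    then show ?thesis using attached_forestD(3)[OF forest, of x] x \<open>n \<notin> N\<close> by auto
  qed simp
next
  show "inj_on (up(n := K)) {x \<in> insert n N. card ((up(n := K)) x) = s}"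
    using attached_forest_inj[OF forest] fresh \<open>n \<notin> N\<close>
    by (intro inj_onI) (auto split: if_splits)
qed

locale clique_forest =
  fixes s :: nat and r :: 'i and N :: "'i set" and up :: "'i \<Rightarrow> 'i set" and par rk
  assumes forest: "attached_forest s {} r N up par rk"
    and finite: "finite N" and root_notin: "r \<notin> N"
begin

definition host_graph :: "'i pair_pre_digraph" where
  "host_graph = \<lparr>pverts = N, parcs = {(x, y). x \<in> N \<and> y \<in> N \<and> (x \<in> up y \<or> y \<in> up x)}\<rparr>"

definition bag :: "'i \<Rightarrow> 'i set" where
  "bag x = (if x = r then {} else insert x (up x))"

lemma up_subset: "x \<in> N \<Longrightarrow> up x \<subseteq> {y \<in> N. rk y < rk x}"
  using attached_forest_up_subset[OF forest] by blast

lemma in_up_parent: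
  assumes "x \<in> N" "v \<in> up x"
  shows "par x \<in> N" "v \<in> insert (par x) (up (par x))"
  using attached_forestD(3)[OF forest assms(1)] assms(2) by auto

lemma pair_graph_host_graph: "pair_graph host_graph"
proof (rule pair_graphI)
  show "irrefl (parcs host_graph)" using up_subset by (auto simp: host_graph_def irrefl_def)
qed (auto simp: host_graph_def sym_def finite)

sublocale rooted_tree "insert r N" r par "\<lambda>x. if x = r then 0 else Suc (rk x)"
  using attached_forestD(3)[OF forest] by unfold_locales auto

lemma tree_decomposition_host_graph: "tree_decomposition host_graph tree_graph bag"
proof -
  have bag_N: "bag x = insert x (up x)" if "x \<in> N" for x
    using that root_notin by (auto simp: bag_def)
  have "connected (with_proj tree_graph \<restriction> {x \<in> insert r N. v \<in> bag x})" if v: "v \<in> N" for v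
  proof -
    let ?M = "{x \<in> insert r N. v \<in> bag x}"
    have "v \<in> ?M" using v bag_N by simp
    moreover have "connected_on (parcs tree_graph) ?M"
    proof (rule connected_on_if_parent_closed[of v])
      fix x assume "x \<in> ?M" "x \<noteq> v"
      then have "x \<in> N" "v \<in> up x" by (auto simp: bag_def split: if_splits)
      then show "x \<noteq> r \<and> par x \<in> ?M" using in_up_parent bag_N root_notin by auto
    qed (use v bag_N in auto)
    ultimately show ?thesis using connected_induce_iff[OF sym_tree_graph] by blast
  qed
  moreover have "bag x \<subseteq> N" if "x \<in> insert r N" for x
    using that up_subset by (auto simp: bag_def)
  moreover have "undirected_tree tree_graph" by (rule undirected_tree_tree_graph) (simp add: finite)
  moreover have "\<exists>x \<in> insert r N. v \<in> bag x \<and> w \<in> bag x" if "(v, w) \<in> parcs host_graph" for v w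
    using that bag_N by (fastforce simp: host_graph_def)
  ultimately show ?thesis
    unfolding tree_decomposition_def by (auto simp: host_graph_def)
qed

lemma card_bags_containing:
  assumes "S \<subseteq> N" "card S = s" "0 < s"
  shows "card {x \<in> insert r N. S \<subseteq> bag x} \<le> 2"
proof -
  have "finite S" "S \<noteq> {}" using assms finite_subset[OF _ finite] by auto
  then obtain m where m: "m \<in> S" "\<forall>y \<in> S. rk y \<le> rk m" using finite_has_arg_max[of S rk] by blast
  have "x \<in> N \<and> up x = S" if "x \<in> insert r N" "S \<subseteq> bag x" "x \<noteq> m" for x
  proof -
    have x: "x \<in> N" "S \<subseteq> insert x (up x)"
      using that \<open>S \<noteq> {}\<close> by (auto simp: bag_def split: if_splits)
    then have "m \<in> up x" using m(1) that(3) by blast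
    then have "x \<notin> S" using up_subset[OF x(1)] m(2) by fastforce
    then have "S \<subseteq> up x" using x(2) by blast
    then show ?thesis using x(1) attached_forestD(1,2)[OF forest x(1)] assms(2) card_seteq by metis
  qed
  then have "{x \<in> insert r N. S \<subseteq> bag x} \<subseteq> insert m {x \<in> N. up x = S}" by blast
  moreover have "finite {x \<in> N. up x = S}" using finite by simp
  moreover have "card {x \<in> N. up x = S} \<le> Suc 0"
    using attached_forest_inj[OF forest] assms(2) card_le_Suc0_iff_eq[OF calculation(2)] by simp
  ultimately show ?thesis
    using card_mono[of "insert m {x \<in> N. up x = S}" "{x \<in> insert r N. S \<subseteq> bag x}"]
    by (simp add: card_insert_if split: if_splits)
qed

lemma k_simple_host_graph:
  assumes "0 < s"
  shows "k_simple s host_graph tree_graph bag"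
proof -
  have "card (bag x) \<le> s + 1" if "x \<in> insert r N" for x
    using that attached_forestD(1,2)[OF forest, of x] by (auto simp: bag_def card_insert_if)
  then show ?thesis
    using card_bags_containing assms unfolding k_simple_def by (simp add: host_graph_def)
qed

end

lemma simple_treewidth_host_graph_le:
  fixes r :: nat
  assumes "clique_forest s r N up par rk" "0 < s"
  shows "simple_treewidth (clique_forest.host_graph N up) \<le> s"
proof -
  interpret clique_forest s r N up par rk by fact
  show ?thesis
    unfolding simple_treewidth_def
    using tree_decomposition_host_graph k_simple_host_graph[OF assms(2)]
    by (intro Least_le exI conjI)
qed

section \<open>Subproblems and separating parts\<close>

text \<open>
  By minimality of a hitting set \<open>X\<close>, the vertex \<open>x\<close> lies on a set \<open>F\<close> that touches \<open>B\<close> and avoids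
  the rest of \<open>X\<close>. Such an \<open>F\<close> cannot enter a union \<open>U\<close> of components of \<open>D - X\<close> that do not
  touch \<open>B\<close>.
\<close>

lemma hitting_set_reachable:
  assumes "sym E" and F: "connected_on E F" "F \<subseteq> D" "F \<inter> X = {x}" "touches E F B"
    and U: "U \<subseteq> D - X" "\<not> touches E U B"
      "\<And>u v. u \<in> U \<Longrightarrow> v \<in> D - X \<Longrightarrow> (u, v) \<in> E \<Longrightarrow> v \<in> U"
  shows "x \<in> reach E (B \<union> (D - U)) B"
proof (rule ccontr)
  let ?M = "reach E (B \<union> (D - U)) B"
  assume "x \<notin> ?M"
  have "B \<subseteq> ?M" by (rule subset_reach) simp
  obtain f b where fb: "f \<in> F" "b \<in> B" "(b, f) \<in> E" "(f, b) \<in> E"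
    using F(4) \<open>sym E\<close> unfolding touches_def by (meson symD)
  have "f \<notin> U" using U(2) fb unfolding touches_def by blast
  have "F \<subseteq> ?M"
  proof (rule connected_on_subsetI[OF F(1)])
    have "f \<in> ?M" using reach_closed[of b E _ B f] \<open>B \<subseteq> ?M\<close> fb \<open>f \<notin> U\<close> F(2) by blast
    then show "F \<inter> ?M \<noteq> {}" using fb(1) by blast
    fix v w assume vw: "v \<in> F" "v \<in> ?M" "w \<in> F" "(v, w) \<in> E"
    show "w \<in> ?M"
    proof (cases "w \<in> U")
      case True
      have "v \<noteq> x" using vw(2) \<open>x \<notin> ?M\<close> by blast
      then have "v \<in> D - X" using vw(1) F(2,3) by blast
      then have "v \<in> U" using U(3)[OF True] symD[OF \<open>sym E\<close> vw(4)] by blast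
      then have "v \<in> B" using vw(2) reach_subset[of E "B \<union> (D - U)" B] by blast
      then have "touches E U B" using True symD[OF \<open>sym E\<close> vw(4)] by (auto simp: touches_def)
      then show ?thesis using U(2) by blast
    next
      case False
      then show ?thesis using reach_closed[OF vw(2,4)] vw(3) F(2) by blast
    qed
  qed
  then show False using F(3) \<open>x \<notin> ?M\<close> by blast
qed

locale Kstar_free_decomposition =
  fixes G :: "'a pair_pre_digraph" and T :: "'n pair_pre_digraph" and W :: "'n \<Rightarrow> 'a set"
    and s t :: nat and name :: "'a \<Rightarrow> nat"
  assumes pair_graph: "pair_graph G" and decomposition: "tree_decomposition G T W"
    and Kstar_free: "Kstar_minor_free s t G" and t_ge_2: "2 \<le> t"
    and inj_name: "inj_on name (pverts G)"
begin

abbreviation E :: "('a \<times> 'a) set" where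
  "E \<equiv> parcs G"

lemma sym_E: "sym E"
  by (rule pair_graph_sym[OF pair_graph])

lemma name_notin: "x \<in> pverts G \<Longrightarrow> A \<subseteq> pverts G \<Longrightarrow> x \<notin> A \<Longrightarrow> name x \<notin> name ` A"
  using inj_name by (auto dest: inj_onD)

definition covered :: "'a set \<Rightarrow> bool" where
  "covered X \<longleftrightarrow> (\<exists>Y \<subseteq> pverts T. finite Y \<and> card Y \<le> t - 1 \<and> X \<subseteq> \<Union>(W ` Y))"

lemma covered_subset: "covered X \<Longrightarrow> X' \<subseteq> X \<Longrightarrow> covered X'"
  unfolding covered_def by (meson order_trans)

definition subproblem :: "'a set \<Rightarrow> nat set \<Rightarrow> (nat \<Rightarrow> 'a set) \<Rightarrow> bool" where
  "subproblem D K V \<longleftrightarrow> D \<subseteq> pverts G \<and> finite K \<and> card K \<le> s \<and> K \<inter> name ` D = {} \<and>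
    model_in G (clique_graph K) V \<and> (\<forall>i \<in> K. V i \<inter> D = {}) \<and>
    (\<forall>u \<in> D. \<forall>w. (u, w) \<in> E \<longrightarrow> w \<in> D \<or> (\<exists>i \<in> K. w \<in> V i))"

lemma subproblemD:
  assumes "subproblem D K V"
  shows "D \<subseteq> pverts G" "finite K" "card K \<le> s" "K \<inter> name ` D = {}"
    and "model_in G (clique_graph K) V" "\<And>i. i \<in> K \<Longrightarrow> V i \<inter> D = {}"
    and "\<And>u w. u \<in> D \<Longrightarrow> (u, w) \<in> E \<Longrightarrow> w \<in> D \<or> (\<exists>i \<in> K. w \<in> V i)"
  using assms unfolding subproblem_def by blast+

lemma subproblemI:
  assumes "D \<subseteq> pverts G" "finite K" "card K \<le> s" "K \<inter> name ` D = {}"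
    and "model_in G (clique_graph K) V" "\<And>i. i \<in> K \<Longrightarrow> V i \<inter> D = {}"
    and "\<And>u w. u \<in> D \<Longrightarrow> (u, w) \<in> E \<Longrightarrow> w \<in> D \<or> (\<exists>i \<in> K. w \<in> V i)"
  shows "subproblem D K V"
  using assms unfolding subproblem_def by blast

definition linked_sets :: "'a set \<Rightarrow> nat set \<Rightarrow> (nat \<Rightarrow> 'a set) \<Rightarrow> 'a set set" where
  "linked_sets D K V =
    {F. F \<subseteq> D \<and> F \<noteq> {} \<and> connected_on E F \<and> (\<forall>i \<in> K. touches E F (V i))}"

lemma linked_setsD:
  assumes "F \<in> linked_sets D K V"
  shows "F \<subseteq> D" "F \<noteq> {}" "connected_on E F" "\<And>i. i \<in> K \<Longrightarrow> touches E F (V i)"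
  using assms by (auto simp: linked_sets_def)

lemma linked_sets_avoiding:
  "F \<in> linked_sets (D - X) K V \<longleftrightarrow> F \<in> linked_sets D K V \<and> F \<inter> X = {}"
  by (auto simp: linked_sets_def)

lemma connected_upset_linked_sets: "connected_upset E D (linked_sets D K V)"
  unfolding connected_upset_def
proof (intro conjI ballI allI impI)
  fix F F' assume "F \<in> linked_sets D K V" "F \<subseteq> F' \<and> F' \<subseteq> D \<and> connected_on E F'"
  then show "F' \<in> linked_sets D K V"
    using touches_mono[of E F _ F'] unfolding linked_sets_def by blast
qed (auto simp: linked_sets_def)

lemma bags_hitting_linked_sets_if_full:
  assumes sub: "subproblem D K V" and full: "card K = s"
  shows "\<exists>Y \<subseteq> pverts T. finite Y \<and> card Y < t \<and> (\<forall>F \<in> linked_sets D K V. F \<inter> \<Union>(W ` Y) \<noteq> {})"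
proof -
  have "\<not> (\<exists>\<S> \<subseteq> linked_sets D K V. finite \<S> \<and> card \<S> = t \<and> disjoint \<S>)"
  proof
    assume "\<exists>\<S> \<subseteq> linked_sets D K V. finite \<S> \<and> card \<S> = t \<and> disjoint \<S>"
    then obtain \<S> where S: "\<S> \<subseteq> linked_sets D K V" "finite \<S>" "card \<S> = t" "disjoint \<S>" by blast
    have "\<not> Kstar_minor_free (card K) (card \<S>) G"
    proof (rule not_Kstar_minor_free[OF pair_graph _ _ S(2,4)])
      fix F assume "F \<in> \<S>"
      then have F: "F \<in> linked_sets D K V" using S(1) by blast
      show "F \<subseteq> pverts G \<and> F \<noteq> {} \<and> connected_on E F"
        using linked_setsD(1-3)[OF F] subproblemD(1)[OF sub] by blast
      show "F \<inter> V i = {} \<and> touches E F (V i)" if "i \<in> K" for i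
        using linked_setsD(1,4)[OF F] subproblemD(6)[OF sub that] that by blast
    qed (use subproblemD[OF sub] in auto)
    then show False using Kstar_free full S(3) by simp
  qed
  then show ?thesis
    using disjoint_subfamily_or_hitting_bags[OF pair_graph decomposition subproblemD(1)[OF sub]
        connected_upset_linked_sets[of D K V], of t] by (simp only: simp_thms)
qed

definition separating_part :: "'a set \<Rightarrow> nat set \<Rightarrow> (nat \<Rightarrow> 'a set) \<Rightarrow> 'a set \<Rightarrow> 'a set \<Rightarrow> bool" where
  "separating_part D K V X Q \<longleftrightarrow> X \<noteq> {} \<and> X \<subseteq> D \<and> covered X \<and>
    (\<forall>x \<in> X. \<exists>F \<in> linked_sets D K V. F \<inter> X = {x}) \<and>
    (\<forall>F \<in> linked_sets (D - X) K V. card K < s \<and> Q \<in> linked_sets D K V \<and> X \<subseteq> Q \<and> F \<inter> Q = {})"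

lemma separating_part_exists_if_full:
  assumes sub: "subproblem D K V" and "card K = s" and "linked_sets D K V \<noteq> {}"
  shows "\<exists>X. separating_part D K V X {}"
proof -
  let ?\<F> = "linked_sets D K V"
  obtain Y where Y: "Y \<subseteq> pverts T" "finite Y" "card Y < t"
    and hit: "\<forall>F \<in> ?\<F>. F \<inter> \<Union>(W ` Y) \<noteq> {}"
    using bags_hitting_linked_sets_if_full[OF assms(1,2)] by blast
  have "F \<inter> (D \<inter> \<Union>(W ` Y)) \<noteq> {}" if "F \<in> ?\<F>" for F
    using hit that linked_setsD(1)[OF that] by blast
  moreover have "finite (D \<inter> \<Union>(W ` Y))"
    using finite_subset[OF subproblemD(1)[OF sub] pair_graph_finite[OF pair_graph]] by simp
  ultimately obtain X where X: "X \<subseteq> D \<inter> \<Union>(W ` Y)" "\<forall>F \<in> ?\<F>. F \<inter> X \<noteq> {}"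
    "\<forall>x \<in> X. \<exists>F \<in> ?\<F>. F \<inter> X = {x}"
    using minimal_hitting_set[of "D \<inter> \<Union>(W ` Y)" ?\<F>] by blast
  have "card Y \<le> t - 1" using Y(3) by simp
  then have "covered X" using X(1) Y(1,2) unfolding covered_def by blast
  moreover have "X \<noteq> {}" using X(2) \<open>?\<F> \<noteq> {}\<close> by blast
  moreover have "linked_sets (D - X) K V = {}"
    using X(2) linked_sets_avoiding[of _ D X K V] by blast
  ultimately have "separating_part D K V X {}"
    using X(1,3) unfolding separating_part_def by blast
  then show ?thesis ..
qed

lemma separating_part_exists_if_not_full:
  assumes sub: "subproblem D K V" and "card K < s" and "linked_sets D K V \<noteq> {}"
  shows "\<exists>X Q. separating_part D K V X Q"
proof -
  let ?\<F> = "linked_sets D K V"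
  obtain Q y where Q: "Q \<in> ?\<F>" "y \<in> pverts T"
    and hit: "\<forall>F \<in> ?\<F>. F \<inter> Q \<noteq> {} \<longrightarrow> F \<inter> Q \<inter> W y \<noteq> {}"
    using bag_hitting_neighbours[OF pair_graph decomposition subproblemD(1)[OF sub]
        connected_upset_linked_sets assms(3)] by blast
  have "F \<inter> (Q \<inter> W y) \<noteq> {}" if "F \<in> {F \<in> ?\<F>. F \<inter> Q \<noteq> {}}" for F
    using hit that by (simp add: Int_assoc)
  moreover have "finite (Q \<inter> W y)"
    using linked_setsD(1)[OF Q(1)] subproblemD(1)[OF sub] pair_graph_finite[OF pair_graph]
    by (meson finite_Int finite_subset)
  ultimately obtain X where X: "X \<subseteq> Q \<inter> W y" "\<forall>F \<in> {F \<in> ?\<F>. F \<inter> Q \<noteq> {}}. F \<inter> X \<noteq> {}"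
    "\<forall>x \<in> X. \<exists>F \<in> {F \<in> ?\<F>. F \<inter> Q \<noteq> {}}. F \<inter> X = {x}"
    using minimal_hitting_set[of "Q \<inter> W y" "{F \<in> ?\<F>. F \<inter> Q \<noteq> {}}"] by blast
  have "covered X"
    unfolding covered_def using X(1) Q(2) t_ge_2 by (intro exI[of _ "{y}"]) auto
  moreover have "X \<noteq> {}" using X(2) Q(1) linked_setsD(2)[OF Q(1)] by blast
  moreover have "X \<subseteq> D" using X(1) linked_setsD(1)[OF Q(1)] by blast
  moreover have "F \<inter> Q = {}" if "F \<in> linked_sets (D - X) K V" for F
    using X(2) that by (auto simp: linked_sets_avoiding)
  moreover have "X \<subseteq> Q" using X(1) by blast
  moreover have "\<exists>F \<in> ?\<F>. F \<inter> X = {x}" if "x \<in> X" for x using X(3) that by blast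
  ultimately have "separating_part D K V X Q"
    using Q(1) \<open>card K < s\<close> by (simp add: separating_part_def)
  then show ?thesis by blast
qed

lemma separating_part_exists:
  assumes "subproblem D K V" "linked_sets D K V \<noteq> {}"
  shows "\<exists>X Q. separating_part D K V X Q"
proof (cases "card K = s")
  case True
  then show ?thesis using separating_part_exists_if_full assms by blast
next
  case False
  then have "card K < s" using subproblemD(3)[OF assms(1)] by simp
  then show ?thesis using separating_part_exists_if_not_full assms by blast
qed

definition attachments :: "'a set \<Rightarrow> nat set \<Rightarrow> (nat \<Rightarrow> 'a set) \<Rightarrow> 'a \<Rightarrow> nat set" where
  "attachments D K V u = {i \<in> K. touches E (reach E D {u}) (V i)}"

lemma attachments_subset: "attachments D K V u \<subseteq> K"
  by (auto simp: attachments_def)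

lemma attachments_adjacent:
  assumes "u \<in> D" "w \<in> D" "(u, w) \<in> E"
  shows "attachments D K V w = attachments D K V u"
proof -
  have "w \<in> reach E D {u}"
    using subset_reach[of "{u}" D E] reach_closed[of u E D "{u}" w] assms by blast
  then show ?thesis unfolding attachments_def by (simp add: reach_singleton_eq[OF sym_E])
qed

lemma attachments_memI:
  assumes "u \<in> D" "i \<in> K" "w \<in> V i" "(u, w) \<in> E"
  shows "i \<in> attachments D K V u"
  using assms subset_reach[of "{u}" D E] by (auto simp: attachments_def touches_def)

lemma reach_in_linked_sets:
  assumes "u \<in> D" "attachments D K V u = K"
  shows "reach E D {u} \<in> linked_sets D K V"
proof -
  have "reach E D {u} \<noteq> {}" using subset_reach[of "{u}" D E] assms(1) by blast
  moreover have "connected_on E (reach E D {u})"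
    using connected_on_reach[OF sym_E connected_on_singleton] assms(1) by blast
  ultimately show ?thesis
    using assms(2) reach_subset[of E D "{u}"] unfolding linked_sets_def attachments_def by blast
qed

definition attachment_class :: "'a set \<Rightarrow> nat set \<Rightarrow> (nat \<Rightarrow> 'a set) \<Rightarrow> nat set \<Rightarrow> 'a set" where
  "attachment_class D K V L = {u \<in> D. attachments D K V u = L}"

lemma attachment_class_subset: "attachment_class D K V L \<subseteq> D"
  by (auto simp: attachment_class_def)

lemma attachment_class_closed:
  assumes "u \<in> attachment_class D K V L" "w \<in> D" "(u, w) \<in> E"
  shows "w \<in> attachment_class D K V L"
  using assms attachments_adjacent by (auto simp: attachment_class_def)

lemma attachment_class_not_touches:
  assumes "i \<in> K - L"
  shows "\<not> touches E (attachment_class D K V L) (V i)"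
  using assms attachments_memI[of _ D i K _ V] by (auto simp: touches_def attachment_class_def)

lemma linked_class_avoids:
  assumes sep: "separating_part D K V X Q" and "u \<in> attachment_class (D - X) K V K"
  shows "card K < s" "Q \<in> linked_sets D K V" "X \<subseteq> Q"
    and "attachment_class (D - X) K V K \<inter> Q = {}"
proof -
  have linked: "reach E (D - X) {v} \<in> linked_sets (D - X) K V"
    if "v \<in> attachment_class (D - X) K V K" for v
    using reach_in_linked_sets[of v "D - X" K V] that by (auto simp: attachment_class_def)
  then show "card K < s" "Q \<in> linked_sets D K V" "X \<subseteq> Q"
    using sep assms(2) unfolding separating_part_def by blast+
  have "v \<notin> Q" if v: "v \<in> attachment_class (D - X) K V K" for v
  proof -
    have "reach E (D - X) {v} \<inter> Q = {}"
      using sep linked[OF v] unfolding separating_part_def by blast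
    then show ?thesis
      using subset_reach[of "{v}" "D - X" E] v attachment_class_subset by blast
  qed
  then show "attachment_class (D - X) K V K \<inter> Q = {}" by blast
qed

lemma enlarged_branch_set:
  assumes sub: "subproblem D K V" and sep: "separating_part D K V X Q" and c: "c \<in> K - L"
  defines "U \<equiv> attachment_class (D - X) K V L"
  defines "B \<equiv> reach E (V c \<union> (D - U)) (V c)"
  shows "X \<subseteq> B" "B \<subseteq> V c \<union> (D - U)" "V c \<subseteq> B" "connected_on E B"
proof -
  show "B \<subseteq> V c \<union> (D - U)" unfolding B_def by (rule reach_subset)
  show "V c \<subseteq> B" unfolding B_def by (rule subset_reach) simp
  show "connected_on E B"
    unfolding B_def using subproblemD(5)[OF sub] c
    by (intro connected_on_reach[OF sym_E]) (auto simp: model_in_clique_graph_iff)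
  show "X \<subseteq> B"
  proof
    fix x assume "x \<in> X"
    then obtain F where F: "F \<in> linked_sets D K V" "F \<inter> X = {x}"
      using sep unfolding separating_part_def by blast
    show "x \<in> B"
      unfolding B_def
    proof (rule hitting_set_reachable[OF sym_E linked_setsD(3,1)[OF F(1)] F(2)])
      show "touches E F (V c)" using linked_setsD(4)[OF F(1)] c by blast
      show "\<not> touches E U (V c)" using attachment_class_not_touches[OF c] by (simp add: U_def)
    qed (use attachment_class_subset attachment_class_closed in \<open>auto simp: U_def\<close>)
  qed
qed

lemma branch_set_exists:
  assumes sub: "subproblem D K V" and sep: "separating_part D K V X Q" and "L \<subseteq> K"
    and u: "u \<in> attachment_class (D - X) K V L"
  shows "\<exists>B. X \<subseteq> B \<and> B \<subseteq> pverts G \<and> connected_on E B \<and>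
    B \<inter> attachment_class (D - X) K V L = {} \<and> (\<forall>i \<in> L. B \<inter> V i = {} \<and> touches E B (V i))"
proof (cases "L = K")
  case True
  note Q = linked_class_avoids[OF sep u[unfolded True]]
  have "Q \<inter> V i = {}" if "i \<in> K" for i
    using subproblemD(6)[OF sub that] linked_setsD(1)[OF Q(2)] by blast
  then show ?thesis
    using Q(3,4) linked_setsD[OF Q(2)] True subproblemD(1)[OF sub] by (intro exI[of _ Q]) blast
next
  case False
  let ?U = "attachment_class (D - X) K V L"
  obtain c where c: "c \<in> K - L" using False \<open>L \<subseteq> K\<close> by blast
  let ?B = "reach E (V c \<union> (D - ?U)) (V c)"
  note B = enlarged_branch_set[OF sub sep c]
  have "V c \<subseteq> pverts G" using subproblemD(5)[OF sub] c by (simp add: model_in_clique_graph_iff)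
  moreover have "?B \<inter> V i = {} \<and> touches E ?B (V i)" if "i \<in> L" for i
  proof -
    have i: "i \<in> K" "c \<noteq> i" using that c \<open>L \<subseteq> K\<close> by auto
    then have "V c \<inter> V i = {}" "touches E (V c) (V i)"
      using subproblemD(5)[OF sub] c by (auto simp: model_in_clique_graph_iff)
    then show ?thesis
      using B(2,3) subproblemD(6)[OF sub i(1)] touches_mono[of E "V c" "V i" ?B "V i"] by blast
  qed
  moreover have "V c \<inter> ?U = {}"
    using subproblemD(6)[OF sub, of c] c attachment_class_subset[of "D - X" K V L] by blast
  ultimately show ?thesis
    using B subproblemD(1)[OF sub] by (intro exI[of _ ?B]) blast
qed

lemma attachment_class_boundary:
  assumes sub: "subproblem D K V" and u: "u \<in> attachment_class (D - X) K V L" and "(u, w) \<in> E"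
  shows "w \<in> attachment_class (D - X) K V L \<or> w \<in> X \<or> (\<exists>i \<in> L. w \<in> V i)"
proof (cases "w \<in> D")
  case True
  then show ?thesis using attachment_class_closed[OF u _ \<open>(u, w) \<in> E\<close>] by blast
next
  case False
  have "u \<in> D" using u attachment_class_subset by blast
  then obtain i where i: "i \<in> K" "w \<in> V i"
    using subproblemD(7)[OF sub _ \<open>(u, w) \<in> E\<close>] False by blast
  then have "i \<in> L"
    using attachment_class_not_touches[of i K L "D - X" V] u \<open>(u, w) \<in> E\<close>
    unfolding touches_def by blast
  then show ?thesis using i(2) by blast
qed

lemma subproblem_attachment_class:
  assumes sub: "subproblem D K V" and "L \<subseteq> K"
  shows "subproblem (attachment_class D K V L) L V"
proof (rule subproblemI)
  let ?U = "attachment_class D K V L"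
  have "?U \<subseteq> D" by (rule attachment_class_subset)
  then show "?U \<subseteq> pverts G" "L \<inter> name ` ?U = {}"
    using subproblemD(1,4)[OF sub] \<open>L \<subseteq> K\<close> by blast+
  show "V i \<inter> ?U = {}" if "i \<in> L" for i
    using subproblemD(6)[OF sub, of i] that \<open>L \<subseteq> K\<close> \<open>?U \<subseteq> D\<close> by blast
  show "finite L" by (rule finite_subset[OF \<open>L \<subseteq> K\<close> subproblemD(2)[OF sub]])
  show "card L \<le> s"
    using card_mono[OF subproblemD(2)[OF sub] \<open>L \<subseteq> K\<close>] subproblemD(3)[OF sub] by simp
  show "model_in G (clique_graph L) V"
    by (rule model_in_clique_graph_subset[OF subproblemD(5)[OF sub] \<open>L \<subseteq> K\<close>])
  show "w \<in> ?U \<or> (\<exists>i \<in> L. w \<in> V i)" if "u \<in> ?U" "(u, w) \<in> E" for u w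
    using attachment_class_boundary[OF sub, of u "{}" L w] that by simp
qed

lemma card_attachments_less:
  assumes sub: "subproblem D K V" and sep: "separating_part D K V X Q"
    and "L \<subseteq> K" "u \<in> attachment_class (D - X) K V L"
  shows "card L < s"
proof (cases "L = K")
  case True
  then show ?thesis using linked_class_avoids(1)[OF sep] assms(4) by simp
next
  case False
  then have "card L < card K"
    using \<open>L \<subseteq> K\<close> by (intro psubset_card_mono[OF subproblemD(2)[OF sub]]) blast
  then show ?thesis using subproblemD(3)[OF sub] by simp
qed

lemma subproblem_attachment_class_insert:
  assumes sub: "subproblem D K V" and sep: "separating_part D K V X Q" and "x \<in> X"
    and "L \<subseteq> K" and u: "u \<in> attachment_class (D - X) K V L"
  shows "\<exists>B. X \<subseteq> B \<and>
    subproblem (attachment_class (D - X) K V L) (insert (name x) L) (V(name x := B))"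
proof -
  let ?U = "attachment_class (D - X) K V L" and ?n = "name x"
  obtain B where B: "X \<subseteq> B" "B \<subseteq> pverts G" "connected_on E B" "B \<inter> ?U = {}"
    and B_touches: "\<forall>i \<in> L. B \<inter> V i = {} \<and> touches E B (V i)"
    using branch_set_exists[OF sub sep \<open>L \<subseteq> K\<close> u] by blast
  have U_subset: "?U \<subseteq> D - X" by (rule attachment_class_subset)
  have "x \<in> D" using sep \<open>x \<in> X\<close> unfolding separating_part_def by blast
  then have "?n \<notin> L" using subproblemD(4)[OF sub] \<open>L \<subseteq> K\<close> by blast
  have "finite L" by (rule finite_subset[OF \<open>L \<subseteq> K\<close> subproblemD(2)[OF sub]])
  have "subproblem ?U (insert ?n L) (V(?n := B))"
  proof (rule subproblemI)
    show "?U \<subseteq> pverts G" using U_subset subproblemD(1)[OF sub] by blast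
    show "finite (insert ?n L)" using \<open>finite L\<close> by simp
    show "card (insert ?n L) \<le> s"
      using card_attachments_less[OF sub sep \<open>L \<subseteq> K\<close> u] \<open>finite L\<close> \<open>?n \<notin> L\<close> by simp
    have "?n \<notin> name ` ?U"
      using name_notin[of x ?U] U_subset \<open>x \<in> D\<close> \<open>x \<in> X\<close> subproblemD(1)[OF sub] by blast
    then show "insert ?n L \<inter> name ` ?U = {}" using subproblemD(4)[OF sub] U_subset \<open>L \<subseteq> K\<close> by blast
    show "model_in G (clique_graph (insert ?n L)) (V(?n := B))"
      using model_in_clique_graph_subset[OF subproblemD(5)[OF sub] \<open>L \<subseteq> K\<close>] B \<open>x \<in> X\<close> B_touches
      by (intro model_in_clique_graph_insert[OF sym_E _ \<open>?n \<notin> L\<close>]) auto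
    show "(V(?n := B)) i \<inter> ?U = {}" if "i \<in> insert ?n L" for i
      using that B(4) subproblemD(6)[OF sub, of i] U_subset \<open>L \<subseteq> K\<close> by auto
    show "w \<in> ?U \<or> (\<exists>i \<in> insert ?n L. w \<in> (V(?n := B)) i)" if "v \<in> ?U" "(v, w) \<in> E" for v w
      using attachment_class_boundary[OF sub that] B(1) \<open>?n \<notin> L\<close> by auto
  qed
  then show ?thesis using B(1) by blast
qed

section \<open>Tree-partitions of subproblems\<close>

text \<open>Parts are named after one of their vertices, so disjoint subproblems use different names.\<close>

definition tree_partition ::
    "nat \<Rightarrow> 'a set \<Rightarrow> nat set \<Rightarrow> ('a \<Rightarrow> nat) \<Rightarrow> (nat \<Rightarrow> nat set) \<Rightarrow> (nat \<Rightarrow> nat) \<Rightarrow> (nat \<Rightarrow> nat) \<Rightarrow> bool" where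
  "tree_partition q D K lab up par rk \<longleftrightarrow>
    lab ` D \<subseteq> name ` D \<and> attached_forest s K q (lab ` D) up par rk \<and>
    (\<forall>i. covered {u \<in> D. lab u = i}) \<and>
    (\<forall>u \<in> D. \<forall>w \<in> D. (u, w) \<in> E \<longrightarrow>
      lab u = lab w \<or> lab u \<in> up (lab w) \<or> lab w \<in> up (lab u))"

lemma tree_partitionD:
  assumes "tree_partition q D K lab up par rk"
  shows "lab ` D \<subseteq> name ` D" "attached_forest s K q (lab ` D) up par rk"
    and "covered {u \<in> D. lab u = i}"
    and "\<And>u w. u \<in> D \<Longrightarrow> w \<in> D \<Longrightarrow> (u, w) \<in> E \<Longrightarrow>
      lab u = lab w \<or> lab u \<in> up (lab w) \<or> lab w \<in> up (lab u)"
  using assms unfolding tree_partition_def by blast+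

lemma tree_partition_up_subset:
  assumes "tree_partition q D K lab up par rk" "u \<in> D"
  shows "up (lab u) \<subseteq> K \<union> name ` D"
  using attached_forest_up_subset[OF tree_partitionD(2)[OF assms(1)], of "lab u"]
    tree_partitionD(1)[OF assms(1)] assms(2) by blast

definition respects_boundary ::
    "'a set \<Rightarrow> nat set \<Rightarrow> (nat \<Rightarrow> 'a set) \<Rightarrow> ('a \<Rightarrow> nat) \<Rightarrow> (nat \<Rightarrow> nat set) \<Rightarrow> bool" where
  "respects_boundary D K V lab up \<longleftrightarrow>
    (\<forall>u \<in> D. \<forall>i \<in> K. \<forall>w \<in> V i. (u, w) \<in> E \<longrightarrow> i \<in> up (lab u))"

definition solvable :: "nat \<Rightarrow> 'a set \<Rightarrow> nat set \<Rightarrow> (nat \<Rightarrow> 'a set) \<Rightarrow> bool" where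
  "solvable q D K V \<longleftrightarrow>
    (\<exists>lab up par rk. tree_partition q D K lab up par rk \<and> respects_boundary D K V lab up)"

lemma vertex_of_label:
  assumes "lab ` C \<subseteq> name ` C" "C \<subseteq> pverts G" "x \<in> lab ` C"
  shows "the_inv_into (pverts G) name x \<in> C"
proof -
  obtain v where "v \<in> C" "x = name v" using assms(1,3) by blast
  then show ?thesis using assms(2) the_inv_into_f_f[OF inj_name] by auto
qed

lemma tree_partition_glue:
  fixes f :: "'a \<Rightarrow> 'c"
  assumes D: "D \<subseteq> pverts G"
    and part: "\<And>c. c \<in> f ` D \<Longrightarrow>
      tree_partition q {u \<in> D. f u = c} (K c) (lab c) (up c) (par c) (rk c)"
    and const: "\<And>u w. u \<in> D \<Longrightarrow> w \<in> D \<Longrightarrow> (u, w) \<in> E \<Longrightarrow> f w = f u"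
    and K: "\<And>c. c \<in> f ` D \<Longrightarrow> finite (K c) \<and> card (K c) \<le> s \<and> K c \<subseteq> K' \<and> K c \<inter> name ` D = {}"
    and inj: "inj_on K (f ` D)"
  defines "index \<equiv> \<lambda>x. f (the_inv_into (pverts G) name x)"
  shows "tree_partition q D K' (\<lambda>u. lab (f u) u)
      (\<lambda>x. up (index x) x) (\<lambda>x. par (index x) x) (\<lambda>x. rk (index x) x)"
    and "\<And>u. u \<in> D \<Longrightarrow> index (lab (f u) u) = f u"
proof -
  let ?D = "\<lambda>c. {u \<in> D. f u = c}"
  have index: "index x = c" if "c \<in> f ` D" "x \<in> lab c ` ?D c" for c x
    using vertex_of_label[OF tree_partitionD(1)[OF part[OF that(1)]] _ that(2)] D
    by (auto simp: index_def)
  show index_lab: "index (lab (f u) u) = f u" if "u \<in> D" for u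
    using index[of "f u" "lab (f u) u"] that by blast
  have labels_eq: "(\<lambda>u. lab (f u) u) ` D = (\<Union>c \<in> f ` D. lab c ` ?D c)"
    by (auto simp: image_iff) metis
  have names: "(\<Union>c \<in> f ` D. lab c ` ?D c) \<subseteq> name ` D" using tree_partitionD(1)[OF part] by blast
  then have disjoint_labels: "K c \<inter> (\<Union>c \<in> f ` D. lab c ` ?D c) = {}" if "c \<in> f ` D" for c
    using K[OF that] by blast
  have "(\<lambda>u. lab (f u) u) ` D \<subseteq> name ` D" using names labels_eq by simp
  moreover have "attached_forest s K' q ((\<lambda>u. lab (f u) u) ` D)
      (\<lambda>x. up (index x) x) (\<lambda>x. par (index x) x) (\<lambda>x. rk (index x) x)"
    unfolding labels_eq
    by (rule attached_forest_UN[where K = K])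
      (use tree_partitionD(2)[OF part] index K disjoint_labels inj_on_subset[OF inj] in auto)
  moreover have "covered {u \<in> D. lab (f u) u = i}" for i
  proof (cases "\<exists>v \<in> D. lab (f v) v = i")
    case True
    then obtain v where v: "v \<in> D" "lab (f v) v = i" by blast
    have "f u = f v" if "u \<in> D" "lab (f u) u = i" for u
      using index_lab[OF that(1)] index_lab[OF v(1)] that(2) v(2) by simp
    then have "{u \<in> D. lab (f u) u = i} \<subseteq> {u \<in> ?D (f v). lab (f v) u = i}" by auto
    then show ?thesis using covered_subset[OF tree_partitionD(3)[OF part]] v(1) by blast
  next
    case False
    then have "{u \<in> D. lab (f u) u = i} = {}" by blast
    then show ?thesis by (simp only:) (auto simp: covered_def intro: exI[of _ "{}"])
  qed
  moreover have "lab (f u) u = lab (f w) w \<or> lab (f u) u \<in> up (index (lab (f w) w)) (lab (f w) w) \<or>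
      lab (f w) w \<in> up (index (lab (f u) u)) (lab (f u) u)"
    if "u \<in> D" "w \<in> D" "(u, w) \<in> E" for u w
    using tree_partitionD(4)[OF part, of "f u" u w] const[OF that]
      index_lab[OF that(1)] index_lab[OF that(2)] that by auto
  ultimately show "tree_partition q D K' (\<lambda>u. lab (f u) u)
      (\<lambda>x. up (index x) x) (\<lambda>x. par (index x) x) (\<lambda>x. rk (index x) x)"
    unfolding tree_partition_def by blast
qed

lemma solvable_glue:
  fixes f :: "'a \<Rightarrow> 'c"
  assumes D: "D \<subseteq> pverts G" and solvable: "\<And>c. c \<in> f ` D \<Longrightarrow> solvable q {u \<in> D. f u = c} (K c) (V c)"
    and const: "\<And>u w. u \<in> D \<Longrightarrow> w \<in> D \<Longrightarrow> (u, w) \<in> E \<Longrightarrow> f w = f u"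
    and K: "\<And>c. c \<in> f ` D \<Longrightarrow> finite (K c) \<and> card (K c) \<le> s \<and> K c \<subseteq> K' \<and> K c \<inter> name ` D = {}"
    and inj: "inj_on K (f ` D)"
  shows "\<exists>lab up par rk. tree_partition q D K' lab up par rk \<and>
    (\<forall>u \<in> D. respects_boundary {u} (K (f u)) (V (f u)) lab up \<and> up (lab u) \<subseteq> K (f u) \<union> name ` D)"
proof -
  have "\<forall>c \<in> f ` D. \<exists>lab up par rk. tree_partition q {u \<in> D. f u = c} (K c) lab up par rk \<and>
    respects_boundary {u \<in> D. f u = c} (K c) (V c) lab up"
    using solvable unfolding solvable_def by blast
  then obtain lab up par rk where pieces: "\<forall>c \<in> f ` D.
      tree_partition q {u \<in> D. f u = c} (K c) (lab c) (up c) (par c) (rk c) \<and>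
      respects_boundary {u \<in> D. f u = c} (K c) (V c) (lab c) (up c)"
    unfolding bchoice_iff by blast
  then have part: "\<And>c. c \<in> f ` D \<Longrightarrow>
      tree_partition q {u \<in> D. f u = c} (K c) (lab c) (up c) (par c) (rk c)" by blast
  note glue = tree_partition_glue[OF D part const K inj]
  have "respects_boundary {u} (K (f u)) (V (f u)) (\<lambda>u. lab (f u) u)
      (\<lambda>x. up (f (the_inv_into (pverts G) name x)) x)" if "u \<in> D" for u
    using pieces glue(2)[of u] that unfolding respects_boundary_def by simp
  moreover have "up (f (the_inv_into (pverts G) name (lab (f u) u))) (lab (f u) u)
      \<subseteq> K (f u) \<union> name ` D"
    if "u \<in> D" for u
    using tree_partition_up_subset[OF part[of "f u"], of u] glue(2)[of u] that by auto
  ultimately show ?thesis using glue(1) by blast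
qed

lemma tree_partition_insert_part:
  assumes "D \<subseteq> pverts G" "X \<subseteq> D" "x \<in> X" "covered X"
    and K: "finite K" "card K \<le> s" "K \<inter> name ` D = {}"
    and part: "tree_partition (name x) (D - X) (insert (name x) K) lab up par rk"
    and adjacent: "\<And>u w. u \<in> D - X \<Longrightarrow> w \<in> X \<Longrightarrow> (u, w) \<in> E \<Longrightarrow> name x \<in> up (lab u)"
    and fresh: "\<And>u. u \<in> D - X \<Longrightarrow> card (up (lab u)) = s \<Longrightarrow> up (lab u) \<noteq> K"
  shows "tree_partition q D K (\<lambda>u. if u \<in> X then name x else lab u) (up(name x := K))
    (par(name x := q)) (\<lambda>y. if y = name x then 0 else Suc (rk y))"
proof -
  let ?n = "name x" and ?lab = "\<lambda>u. if u \<in> X then name x else lab u"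
  have "?n \<notin> name ` (D - X)" using name_notin[of x "D - X"] assms(1-3) by blast
  then have "?n \<notin> lab ` (D - X)" using tree_partitionD(1)[OF part] by blast
  then have lab_n: "lab u \<noteq> ?n" if "u \<in> D - X" for u using that by (metis imageI)
  have labels_eq: "?lab ` D = insert ?n (lab ` (D - X))" using assms(2,3) by auto
  then have "?lab ` D \<subseteq> name ` D" using tree_partitionD(1)[OF part] assms(2,3) by blast
  moreover have "attached_forest s K q (?lab ` D) (up(?n := K)) (par(?n := q))
      (\<lambda>y. if y = ?n then 0 else Suc (rk y))"
    unfolding labels_eq
    by (rule attached_forest_insert[OF tree_partitionD(2)[OF part] K(1,2) \<open>?n \<notin> lab ` (D - X)\<close>])
      (use fresh in auto)
  moreover have "covered {u \<in> D. ?lab u = i}" for i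
  proof (cases "i = ?n")
    case True
    then have "{u \<in> D. ?lab u = i} \<subseteq> X" using lab_n by auto
    then show ?thesis by (rule covered_subset[OF \<open>covered X\<close>])
  next
    case False
    then have "{u \<in> D. ?lab u = i} \<subseteq> {u \<in> D - X. lab u = i}" by auto
    then show ?thesis by (rule covered_subset[OF tree_partitionD(3)[OF part]])
  qed
  moreover have "?lab u = ?lab w \<or> ?lab u \<in> (up(?n := K)) (?lab w) \<or>
      ?lab w \<in> (up(?n := K)) (?lab u)"
    if uw: "u \<in> D" "w \<in> D" "(u, w) \<in> E" for u w
    using adjacent[of u w] adjacent[of w u] tree_partitionD(4)[OF part, of u w]
      lab_n[of u] lab_n[of w] uw symD[OF sym_E uw(3)] by auto
  ultimately show ?thesis unfolding tree_partition_def by blast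
qed

lemma solvable_if_no_linked_set:
  assumes sub: "subproblem D K V" and none: "linked_sets D K V = {}"
    and IH: "\<And>L. L \<subset> K \<Longrightarrow> solvable q (attachment_class D K V L) L V"
  shows "solvable q D K V"
proof -
  let ?f = "attachments D K V"
  have f: "?f u \<subset> K" if "u \<in> D" for u
    using reach_in_linked_sets[OF that, of K V] attachments_subset[of D K V u] none by blast
  have "\<exists>lab up par rk. tree_partition q D K lab up par rk \<and>
    (\<forall>u \<in> D. respects_boundary {u} (?f u) V lab up \<and> up (lab u) \<subseteq> ?f u \<union> name ` D)"
  proof (rule solvable_glue[where K = id and V = "\<lambda>_. V", unfolded id_apply])
    show "solvable q {u \<in> D. ?f u = L} L V" if "L \<in> ?f ` D" for L
      using IH[of L] f that by (auto simp: attachment_class_def)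
    show "finite L \<and> card L \<le> s \<and> L \<subseteq> K \<and> L \<inter> name ` D = {}" if "L \<in> ?f ` D" for L
    proof -
      have "L \<subseteq> K" using f that by blast
      moreover have "card L \<le> card K" using card_mono[OF subproblemD(2)[OF sub] \<open>L \<subseteq> K\<close>] .
      ultimately show ?thesis using subproblemD(2-4)[OF sub] finite_subset by fastforce
    qed
  qed (use attachments_adjacent subproblemD(1)[OF sub] in auto)
  then obtain lab up par rk where part: "tree_partition q D K lab up par rk"
    and boundary: "\<And>u. u \<in> D \<Longrightarrow> respects_boundary {u} (?f u) V lab up" by blast
  have "respects_boundary D K V lab up"
    using boundary attachments_memI unfolding respects_boundary_def by blast
  then show ?thesis using part unfolding solvable_def by blast
qed

lemma tree_partition_outside_separating_part:
  assumes sub: "subproblem D K V" and sep: "separating_part D K V X Q" and "x \<in> X"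
    and IH: "\<And>n L V'. L \<subseteq> K \<Longrightarrow> subproblem (attachment_class (D - X) K V L) (insert n L) V' \<Longrightarrow>
      solvable n (attachment_class (D - X) K V L) (insert n L) V'"
  defines "n \<equiv> name x"
  shows "\<exists>lab up par rk. tree_partition n (D - X) (insert n K) lab up par rk \<and>
    respects_boundary (D - X) (insert n K) (V(n := X)) lab up \<and>
    (\<forall>u \<in> D - X. up (lab u) \<subseteq> insert n (attachments (D - X) K V u) \<union> name ` (D - X))"
proof -
  let ?f = "attachments (D - X) K V"
  have "X \<subseteq> D" using sep unfolding separating_part_def by blast
  have "n \<notin> K" using subproblemD(4)[OF sub] \<open>x \<in> X\<close> \<open>X \<subseteq> D\<close> by (auto simp: n_def)
  have "n \<notin> name ` (D - X)"
    using name_notin[of x "D - X"] subproblemD(1)[OF sub] \<open>X \<subseteq> D\<close> \<open>x \<in> X\<close> by (auto simp: n_def)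
  have subset_K: "L \<subseteq> K" if "L \<in> ?f ` (D - X)" for L using that attachments_subset by blast
  have "\<exists>B. X \<subseteq> B \<and> subproblem (attachment_class (D - X) K V L) (insert n L) (V(n := B))"
    if L: "L \<in> ?f ` (D - X)" for L
  proof -
    obtain u where "u \<in> attachment_class (D - X) K V L" using L by (auto simp: attachment_class_def)
    then show ?thesis
      using subproblem_attachment_class_insert[OF sub sep \<open>x \<in> X\<close> subset_K[OF L]]
      by (simp add: n_def)
  qed
  then obtain B where X_subset: "\<And>L. L \<in> ?f ` (D - X) \<Longrightarrow> X \<subseteq> B L"
    and B: "\<And>L. L \<in> ?f ` (D - X) \<Longrightarrow>
      subproblem (attachment_class (D - X) K V L) (insert n L) (V(n := B L))"
    by metis
  have "\<exists>lab up par rk. tree_partition n (D - X) (insert n K) lab up par rk \<and>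
    (\<forall>u \<in> D - X. respects_boundary {u} (insert n (?f u)) (V(n := B (?f u))) lab up \<and>
      up (lab u) \<subseteq> insert n (?f u) \<union> name ` (D - X))"
  proof (rule solvable_glue[where K = "insert n"])
    show "D - X \<subseteq> pverts G" using subproblemD(1)[OF sub] by blast
    show "solvable n {u \<in> D - X. ?f u = L} (insert n L) (V(n := B L))" if "L \<in> ?f ` (D - X)" for L
      using IH[OF subset_K B] that by (simp add: attachment_class_def)
    show "finite (insert n L) \<and> card (insert n L) \<le> s \<and> insert n L \<subseteq> insert n K \<and>
        insert n L \<inter> name ` (D - X) = {}" if "L \<in> ?f ` (D - X)" for L
      using subproblemD(2,3)[OF B[OF that]] subset_K[OF that] subproblemD(4)[OF sub]
        \<open>n \<notin> name ` (D - X)\<close> by blast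
    have "n \<notin> L" if "L \<in> ?f ` (D - X)" for L using subset_K[OF that] \<open>n \<notin> K\<close> by blast
    then show "inj_on (insert n) (?f ` (D - X))" by (meson inj_onI insert_ident)
  qed (rule attachments_adjacent)
  then obtain lab up par rk where part: "tree_partition n (D - X) (insert n K) lab up par rk"
    and boundary: "\<And>u. u \<in> D - X \<Longrightarrow>
      respects_boundary {u} (insert n (?f u)) (V(n := B (?f u))) lab up"
    and up: "\<And>u. u \<in> D - X \<Longrightarrow> up (lab u) \<subseteq> insert n (?f u) \<union> name ` (D - X)" by blast
  have "i \<in> up (lab u)"
    if u: "u \<in> D - X" and i: "i \<in> insert n K" "w \<in> (V(n := X)) i" "(u, w) \<in> E" for u i w
  proof -
    have "i \<in> insert n (?f u)" "w \<in> (V(n := B (?f u))) i"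
      using u i X_subset[of "?f u"] attachments_memI[of u "D - X" i K w V]
      by (auto split: if_splits)
    then show ?thesis using boundary[OF u] i(3) unfolding respects_boundary_def by blast
  qed
  then have "respects_boundary (D - X) (insert n K) (V(n := X)) lab up"
    unfolding respects_boundary_def by blast
  then show ?thesis using part up by blast
qed

lemma solvable_if_separating_part:
  assumes sub: "subproblem D K V" and sep: "separating_part D K V X Q"
    and IH: "\<And>n L V'. L \<subseteq> K \<Longrightarrow> subproblem (attachment_class (D - X) K V L) (insert n L) V' \<Longrightarrow>
      solvable n (attachment_class (D - X) K V L) (insert n L) V'"
  shows "solvable q D K V"
proof -
  let ?f = "attachments (D - X) K V"
  have X: "X \<noteq> {}" "X \<subseteq> D" "covered X" using sep unfolding separating_part_def by blast+
  then obtain x where "x \<in> X" by blast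
  define n where "n = name x"
  have "n \<notin> K" using subproblemD(4)[OF sub] \<open>x \<in> X\<close> X(2) by (auto simp: n_def)
  obtain lab up par rk where part: "tree_partition n (D - X) (insert n K) lab up par rk"
    and boundary: "respects_boundary (D - X) (insert n K) (V(n := X)) lab up"
    and up: "\<forall>u \<in> D - X. up (lab u) \<subseteq> insert n (?f u) \<union> name ` (D - X)"
    using tree_partition_outside_separating_part[OF sub sep \<open>x \<in> X\<close> IH] unfolding n_def by blast
  have "tree_partition q D K (\<lambda>u. if u \<in> X then n else lab u) (up(n := K))
      (par(n := q)) (\<lambda>y. if y = n then 0 else Suc (rk y))"
    unfolding n_def
  proof (rule tree_partition_insert_part[OF subproblemD(1)[OF sub] X(2) \<open>x \<in> X\<close> X(3)
        subproblemD(2-4)[OF sub] part[unfolded n_def]])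
    show "name x \<in> up (lab u)" if "u \<in> D - X" "w \<in> X" "(u, w) \<in> E" for u w
      using boundary that unfolding respects_boundary_def n_def by auto
    show "up (lab u) \<noteq> K" if u: "u \<in> D - X" "card (up (lab u)) = s" for u
    proof
      assume "up (lab u) = K"
      then have "K \<subseteq> ?f u" using up u(1) \<open>n \<notin> K\<close> subproblemD(4)[OF sub] by blast
      then have "u \<in> attachment_class (D - X) K V K"
        using attachments_subset[of "D - X" K V u] u(1) by (simp add: attachment_class_def)
      then have "card K < s" by (rule linked_class_avoids(1)[OF sep])
      then show False using u(2) \<open>up (lab u) = K\<close> by simp
    qed
  qed
  moreover have "i \<in> (up(n := K)) (if u \<in> X then n else lab u)"
    if "u \<in> D" "i \<in> K" "w \<in> V i" "(u, w) \<in> E" for u i w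
  proof (cases "u \<in> X")
    case False
    have "w \<in> (V(n := X)) i" using that(2,3) \<open>n \<notin> K\<close> by auto
    then have "i \<in> up (lab u)" using boundary that False unfolding respects_boundary_def by blast
    then show ?thesis using False \<open>i \<in> K\<close> by simp
  qed (use \<open>i \<in> K\<close> in simp)
  ultimately show ?thesis unfolding solvable_def respects_boundary_def by blast
qed

lemma solvable_subproblem:
  assumes "subproblem D K V"
  shows "solvable q D K V"
  using assms
proof (induction "2 * card D + card K" arbitrary: D K V q rule: less_induct)
  case less
  note sub = less.prems
  have fin: "finite D" "finite K"
    using finite_subset[OF subproblemD(1)[OF sub] pair_graph_finite[OF pair_graph]]
      subproblemD(2)[OF sub] .
  show ?case
  proof (cases "linked_sets D K V = {}")
    case True
    show ?thesis
    proof (rule solvable_if_no_linked_set[OF sub True])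
      fix L assume "L \<subset> K"
      have "card (attachment_class D K V L) \<le> card D" "card L < card K"
        using card_mono[OF fin(1) attachment_class_subset] psubset_card_mono[OF fin(2) \<open>L \<subset> K\<close>] .
      then show "solvable q (attachment_class D K V L) L V"
        using \<open>L \<subset> K\<close> by (intro less.hyps subproblem_attachment_class[OF sub]) auto
    qed
  next
    case False
    then obtain X Q where sep: "separating_part D K V X Q"
      using separating_part_exists[OF sub] by blast
    show ?thesis
    proof (rule solvable_if_separating_part[OF sub sep])
      fix n L V'
      let ?U = "attachment_class (D - X) K V L"
      assume "L \<subseteq> K" and sub': "subproblem ?U (insert n L) V'"
      have "?U \<subset> D"
        using attachment_class_subset[of "D - X" K V L] sep unfolding separating_part_def by blast
      then have "card ?U < card D" by (rule psubset_card_mono[OF fin(1)])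
      moreover have "card L \<le> card K" using card_mono[OF fin(2) \<open>L \<subseteq> K\<close>] .
      moreover have "card (insert n L) \<le> Suc (card L)"
        using finite_subset[OF \<open>L \<subseteq> K\<close> fin(2)] by (simp add: card_insert_if)
      ultimately have "2 * card ?U + card (insert n L) < 2 * card D + card K" by linarith
      then show "solvable n ?U (insert n L) V'" using less.hyps sub' by blast
    qed
  qed
qed

end

lemma (in Kstar_free_decomposition) partition_exists:
  assumes "0 < s" "0 \<notin> name ` pverts G"
  shows "\<exists>(H :: nat pair_pre_digraph) lab. pair_graph H \<and> simple_treewidth H \<le> s \<and>
    (\<forall>(u, w) \<in> E. lab u = lab w \<or> (lab u, lab w) \<in> parcs H) \<and> lab ` pverts G \<subseteq> pverts H \<and>
    (\<forall>i. covered {u \<in> pverts G. lab u = i})"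
proof -
  have "subproblem (pverts G) {} (\<lambda>_. {})"
    by (rule subproblemI)
      (use pair_graph_arcsD(2)[OF pair_graph] in \<open>auto simp: model_in_clique_graph_iff\<close>)
  then obtain lab up par rk where part: "tree_partition 0 (pverts G) {} lab up par rk"
    using solvable_subproblem unfolding solvable_def by blast
  let ?N = "lab ` pverts G"
  have forest: "clique_forest s 0 ?N up par rk"
    using tree_partitionD(1,2)[OF part] assms(2) pair_graph_finite[OF pair_graph]
    by unfold_locales auto
  let ?H = "clique_forest.host_graph ?N up"
  note H = clique_forest.host_graph_def[OF forest]
  have "lab u = lab w \<or> (lab u, lab w) \<in> parcs ?H" if "(u, w) \<in> E" for u w
    using tree_partitionD(4)[OF part _ _ that] pair_graph_arcsD(1,2)[OF pair_graph that]
    by (auto simp: H)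
  moreover have "pair_graph ?H" by (rule clique_forest.pair_graph_host_graph[OF forest])
  moreover have "simple_treewidth ?H \<le> s"
    by (rule simple_treewidth_host_graph_le[OF forest assms(1)])
  ultimately show ?thesis
    using tree_partitionD(3)[OF part] by (intro exI[of _ ?H] exI[of _ lab]) (auto simp: H)
qed

lemma Kstar_minor_free_partition_exists:
  fixes G :: "'a pair_pre_digraph"
  assumes "pair_graph G" "tree_decomposition G T W" "Kstar_minor_free s t G" "0 < s" "2 \<le> t"
  shows "\<exists>(H :: nat pair_pre_digraph) lab. pair_graph H \<and> simple_treewidth H \<le> s \<and>
    (\<forall>(u, w) \<in> parcs G. lab u = lab w \<or> (lab u, lab w) \<in> parcs H) \<and> lab ` pverts G \<subseteq> pverts H \<and>
    (\<forall>i. \<exists>Y \<subseteq> pverts T. finite Y \<and> card Y \<le> t - 1 \<and> {u \<in> pverts G. lab u = i} \<subseteq> \<Union>(W ` Y))"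
proof -
  obtain name :: "'a \<Rightarrow> nat" where "inj_on name (pverts G)"
    using finite_imp_inj_to_nat_seg[OF pair_graph_finite[OF assms(1)]] by blast
  then have "inj_on (Suc \<circ> name) (pverts G)" by (simp add: comp_inj_on)
  then interpret Kstar_free_decomposition G T W s t "Suc \<circ> name"
    by (rule Kstar_free_decomposition.intro[OF assms(1-3,5)])
  show ?thesis using partition_exists[OF assms(4)] unfolding covered_def by auto
qed

section \<open>Product structure\<close>

definition weak_arcs :: "'a pair_pre_digraph \<Rightarrow> ('a \<times> 'a) set" where
  "weak_arcs G = parcs G \<union> Id_on (pverts G)"

lemma weak_arcs_strong_product:
  assumes "pair_graph A" "pair_graph B"
  shows "((v, x), (w, y)) \<in> weak_arcs (A \<boxtimes> B) \<longleftrightarrow> (v, w) \<in> weak_arcs A \<and> (x, y) \<in> weak_arcs B"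
  using pair_graph_arcsD[OF assms(1), of v w] pair_graph_arcsD[OF assms(2), of x y]
  by (auto simp: weak_arcs_def strong_product_def)

lemma pair_graph_strong_product:
  assumes "pair_graph A" "pair_graph B"
  shows "pair_graph (A \<boxtimes> B)"
proof (rule pair_graphI)
  show "finite (pverts (A \<boxtimes> B))"
    using assms[THEN pair_graph_finite] by (simp add: strong_product_def)
  show "sym (parcs (A \<boxtimes> B))"
    using assms[THEN pair_graph_sym] unfolding strong_product_def sym_def by auto
qed (auto simp: strong_product_def irrefl_def)

lemma contained_inI:
  assumes G: "pair_graph G" and X: "pair_graph X" and inj: "inj_on \<phi> (pverts G)"
    and verts: "\<phi> ` pverts G \<subseteq> pverts X"
    and arcs: "\<And>u w. (u, w) \<in> parcs G \<Longrightarrow> (\<phi> u, \<phi> w) \<in> weak_arcs X"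
  shows "contained_in G X"
proof -
  have "(\<phi> u, \<phi> w) \<in> parcs X" if "(u, w) \<in> parcs G" for u w
    using arcs[OF that] inj_onD[OF inj] pair_graph_arcsD[OF G that] by (auto simp: weak_arcs_def)
  then have "parcs (quotient_graph \<phi> G) \<subseteq> parcs X" by (auto elim!: quotient_graph_arcE)
  then have "subgraph (with_proj (quotient_graph \<phi> G)) (with_proj X)"
    using verts by (intro subgraph_with_projI pair_graph_quotient_graph G X) simp_all
  then show ?thesis
    unfolding contained_in_def
    using pair_graph_quotient_graph[OF G] digraph_iso_quotient_graph[OF G inj] by blast
qed

definition path_upto :: "nat \<Rightarrow> nat pair_pre_digraph" where
  "path_upto N = \<lparr>pverts = {..N}, parcs = {(a, b). a \<le> N \<and> b \<le> N \<and> (b = Suc a \<or> a = Suc b)}\<rparr>"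

lemma pair_graph_path_upto: "pair_graph (path_upto N)"
  by (rule pair_graphI) (auto simp: path_upto_def sym_def irrefl_def)

lemma path_graph_path_upto: "path_graph (path_upto N)"
  unfolding path_graph_def
proof (intro exI[of _ "[0..<Suc N]"] conjI)
  have nth: "[0..<Suc N] ! i = i" if "i < Suc N" for i using that by (simp del: upt_Suc)
  show "parcs (path_upto N) = {(u, v). \<exists>i. Suc i < length [0..<Suc N] \<and>
      ((u = [0..<Suc N] ! i \<and> v = [0..<Suc N] ! Suc i) \<or>
       (u = [0..<Suc N] ! Suc i \<and> v = [0..<Suc N] ! i))}"
    by (auto simp: path_upto_def nth Suc_le_eq simp del: upt_Suc cong: conj_cong)
qed (auto simp: path_upto_def)

lemma weak_arcs_path_upto:
  "(a, b) \<in> weak_arcs (path_upto N) \<longleftrightarrow> a \<le> N \<and> b \<le> N \<and> \<bar>int a - int b\<bar> \<le> 1"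
  by (auto simp: weak_arcs_def path_upto_def Id_on_iff)

lemma complete_digraph_clique_graph: "complete_digraph m (with_proj (clique_graph {..<m}))"
  unfolding complete_digraph_pair_def by (auto simp: clique_graph_def)

lemma weak_arcs_clique_graph: "weak_arcs (clique_graph A) = A \<times> A"
  by (auto simp: weak_arcs_def clique_graph_def)

lemma layering_index_exists:
  assumes "pair_graph G" "layering G L"
  shows "\<exists>y. (\<forall>u \<in> pverts G. u \<in> L (y u)) \<and> (\<forall>(u, w) \<in> parcs G. \<bar>int (y u) - int (y w)\<bar> \<le> 1)"
proof -
  have "\<forall>u \<in> pverts G. \<exists>i. u \<in> L i" using assms(2) unfolding layering_def by blast
  from bchoice[OF this] obtain y where y: "\<forall>u \<in> pverts G. u \<in> L (y u)" ..
  have "\<bar>int (y u) - int (y w)\<bar> \<le> 1" if "(u, w) \<in> parcs G" for u w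
  proof -
    have "u \<in> L (y u)" "w \<in> L (y w)" using y pair_graph_arcsD(1,2)[OF assms(1) that] by auto
    then show ?thesis using assms(2) that unfolding layering_def by blast
  qed
  then show ?thesis using y by (intro exI[of _ y]) blast
qed

lemma bounded_fibres_numbering:
  fixes f :: "'a \<Rightarrow> 'b"
  assumes "finite A" "\<And>z. card {u \<in> A. f u = z} \<le> m"
  shows "\<exists>g :: 'a \<Rightarrow> nat. g ` A \<subseteq> {..<m} \<and> inj_on (\<lambda>u. (f u, g u)) A"
proof -
  have "\<forall>z. \<exists>h :: 'a \<Rightarrow> nat. h ` {u \<in> A. f u = z} \<subseteq> {..<m} \<and> inj_on h {u \<in> A. f u = z}"
    using assms by (intro allI card_le_inj) auto
  from choice[OF this] obtain h :: "'b \<Rightarrow> 'a \<Rightarrow> nat" where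
    h: "\<And>z. h z ` {u \<in> A. f u = z} \<subseteq> {..<m}" "\<And>z. inj_on (h z) {u \<in> A. f u = z}"
    by blast
  have "h (f u) u < m" if "u \<in> A" for u using h(1)[of "f u"] that by blast
  moreover have "inj_on (\<lambda>u. (f u, h (f u) u)) A"
  proof (rule inj_onI)
    fix u w assume "u \<in> A" "w \<in> A" "(f u, h (f u) u) = (f w, h (f w) w)"
    then show "u = w" using inj_onD[OF h(2)[of "f u"], of u w] by auto
  qed
  ultimately show ?thesis by (intro exI[of _ "\<lambda>u. h (f u) u"]) auto
qed

lemma contained_in_strong_product:
  fixes G :: "'a pair_pre_digraph"
  assumes G: "pair_graph G" and H: "pair_graph H" and L: "layering G L"
    and lab: "lab ` pverts G \<subseteq> pverts H"
      "\<And>u w. (u, w) \<in> parcs G \<Longrightarrow> lab u = lab w \<or> (lab u, lab w) \<in> parcs H"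
    and card: "\<And>i l. card {u \<in> L l. lab u = i} \<le> m"
  shows "\<exists>N. contained_in G (H \<boxtimes> path_upto N \<boxtimes> clique_graph {..<m})"
proof -
  note finite_G = pair_graph_finite[OF G]
  obtain y where y: "\<And>u. u \<in> pverts G \<Longrightarrow> u \<in> L (y u)"
    and y_arc: "\<And>u w. (u, w) \<in> parcs G \<Longrightarrow> \<bar>int (y u) - int (y w)\<bar> \<le> 1"
    using layering_index_exists[OF G L] by blast
  define N where "N = Max (y ` pverts G)"
  have yN: "y u \<le> N" if "u \<in> pverts G" for u unfolding N_def using finite_G that by simp
  have "card {u \<in> pverts G. (lab u, y u) = z} \<le> m" for z
  proof -
    have "{u \<in> pverts G. (lab u, y u) = z} \<subseteq> {u \<in> L (snd z). lab u = fst z}" using y by auto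
    moreover have "finite (L (snd z))"
      using L finite_subset[OF _ finite_G] by (auto simp: layering_def)
    ultimately have "card {u \<in> pverts G. (lab u, y u) = z} \<le> card {u \<in> L (snd z). lab u = fst z}"
      by (intro card_mono) simp_all
    then show ?thesis using card[of "snd z" "fst z"] by simp
  qed
  from bounded_fibres_numbering[OF finite_G this] obtain g :: "'a \<Rightarrow> nat" where
    g: "g ` pverts G \<subseteq> {..<m}" "inj_on (\<lambda>u. ((lab u, y u), g u)) (pverts G)" by blast
  have "contained_in G (H \<boxtimes> path_upto N \<boxtimes> clique_graph {..<m})"
  proof (rule contained_inI[OF G _ g(2)])
    show "pair_graph (H \<boxtimes> path_upto N \<boxtimes> clique_graph {..<m})"
      by (intro pair_graph_strong_product H pair_graph_path_upto pair_graph_clique_graph) simp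
    show "(\<lambda>u. ((lab u, y u), g u)) ` pverts G \<subseteq> pverts (H \<boxtimes> path_upto N \<boxtimes> clique_graph {..<m})"
      using lab(1) yN g(1) by (auto simp: strong_product_def path_upto_def clique_graph_def)
    fix u w assume uw: "(u, w) \<in> parcs G"
    note uw' = pair_graph_arcsD(1,2)[OF G uw]
    have "(lab u, lab w) \<in> weak_arcs H" using lab(1) lab(2)[OF uw] uw' by (auto simp: weak_arcs_def)
    moreover have "(y u, y w) \<in> weak_arcs (path_upto N)"
      using y_arc[OF uw] yN uw' by (simp add: weak_arcs_path_upto)
    moreover have "(g u, g w) \<in> weak_arcs (clique_graph {..<m})"
      using g(1) uw' by (auto simp: weak_arcs_clique_graph)
    ultimately show "(((lab u, y u), g u), ((lab w, y w), g w))
        \<in> weak_arcs (H \<boxtimes> path_upto N \<boxtimes> clique_graph {..<m})"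
      using H pair_graph_path_upto
      by (simp add: weak_arcs_strong_product pair_graph_strong_product pair_graph_clique_graph)
  qed
  then show ?thesis ..
qed

lemma tree_decomposition_single_bag:
  assumes "pair_graph G"
  shows "tree_decomposition G \<lparr>pverts = {x}, parcs = {}\<rparr> (\<lambda>_. pverts G)"
proof -
  let ?T = "\<lparr>pverts = {x}, parcs = {}\<rparr>"
  interpret rooted_tree "{x}" x id "\<lambda>_. 0" by unfold_locales auto
  have "tree_graph = ?T" by (simp add: tree_graph_def parent_arcs_def)
  then have "undirected_tree ?T" using undirected_tree_tree_graph by simp
  moreover have "connected (with_proj ?T \<restriction> {z \<in> {x}. v \<in> pverts G})" if "v \<in> pverts G" for v
    using connected_induce_iff[of ?T "{x}"] connected_on_singleton[of "{}" x] that
    by (simp add: sym_def)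
  moreover have "v \<in> pverts G" "w \<in> pverts G" if "(v, w) \<in> parcs G" for v w
    using pair_graph_arcsD[OF assms that] by auto
  ultimately show ?thesis unfolding tree_decomposition_def by auto
qed

lemma layered_treewidth_attained:
  assumes "pair_graph G"
  shows "\<exists>L (T :: nat pair_pre_digraph) W. layering G L \<and> tree_decomposition G T W \<and>
    (\<forall>i. \<forall>x \<in> pverts T. card (L i \<inter> W x) \<le> layered_treewidth G)"
proof -
  let ?L = "\<lambda>i::nat. if i = 0 then pverts G else {}"
  have "layering G ?L" unfolding layering_def by auto
  then have "\<exists>k L (T :: nat pair_pre_digraph) W. layering G L \<and> tree_decomposition G T W \<and>
      (\<forall>i. \<forall>x \<in> pverts T. card (L i \<inter> W x) \<le> k)"
    using tree_decomposition_single_bag[OF assms, of 0]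
    by (intro exI[of _ "card (pverts G)"] exI[of _ ?L] exI conjI) auto
  then show ?thesis unfolding layered_treewidth_def by (rule LeastI_ex)
qed

lemma card_le_if_covered:
  assumes "finite L" "X \<subseteq> L" "X \<subseteq> \<Union>(W ` Y)" "finite Y" "card Y \<le> c"
    and "\<And>x. x \<in> Y \<Longrightarrow> card (L \<inter> W x) \<le> k"
  shows "card X \<le> c * k"
proof -
  have "X \<subseteq> (\<Union>x \<in> Y. L \<inter> W x)" using assms(2,3) by blast
  then have "card X \<le> card (\<Union>x \<in> Y. L \<inter> W x)"
    by (rule card_mono[rotated]) (use assms(1,4) in auto)
  also have "\<dots> \<le> (\<Sum>x \<in> Y. card (L \<inter> W x))" by (rule card_UN_le[OF assms(4)])
  also have "\<dots> \<le> card Y * k" using sum_bounded_above[of Y "\<lambda>x. card (L \<inter> W x)" k] assms(6) by simp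
  also have "\<dots> \<le> c * k" using assms(5) by (rule mult_le_mono1)
  finally show ?thesis .
qed

theorem theorem29:
  fixes s t :: nat and G :: "'a pair_pre_digraph"
  assumes "2 \<le> s" and "2 \<le> t"
    and "pair_graph G"
    and "Kstar_minor_free s t G"
  shows "\<exists>(H :: nat pair_pre_digraph) (P :: nat pair_pre_digraph) (K :: nat pair_pre_digraph).
    pair_graph H \<and> simple_treewidth H \<le> s \<and>
    path_graph P \<and>
    complete_digraph ((t - 1) * layered_treewidth G) (with_proj K) \<and>
    contained_in G (H \<boxtimes> P \<boxtimes> K)"
proof -
  let ?m = "(t - 1) * layered_treewidth G"
  obtain L and T :: "nat pair_pre_digraph" and W where L: "layering G L"
    and td: "tree_decomposition G T W"
    and bag_layer: "\<forall>i. \<forall>x \<in> pverts T. card (L i \<inter> W x) \<le> layered_treewidth G"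
    using layered_treewidth_attained[OF assms(3)] by blast
  obtain H :: "nat pair_pre_digraph" and lab where H: "pair_graph H" "simple_treewidth H \<le> s"
    and lab: "\<forall>(u, w) \<in> parcs G. lab u = lab w \<or> (lab u, lab w) \<in> parcs H"
      "lab ` pverts G \<subseteq> pverts H"
    and parts: "\<forall>i. \<exists>Y \<subseteq> pverts T. finite Y \<and> card Y \<le> t - 1 \<and> {u \<in> pverts G. lab u = i} \<subseteq> \<Union>(W ` Y)"
    using Kstar_minor_free_partition_exists[OF assms(3) td assms(4) _ assms(2)] assms(1) by auto
  have "card {u \<in> L l. lab u = i} \<le> ?m" for i l
  proof -
    obtain Y where Y: "Y \<subseteq> pverts T" "finite Y" "card Y \<le> t - 1"
      "{u \<in> pverts G. lab u = i} \<subseteq> \<Union>(W ` Y)" using spec[OF parts, of i] by blast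
    have "L l \<subseteq> pverts G" using L unfolding layering_def by blast
    then show ?thesis
      using Y bag_layer finite_subset[OF _ pair_graph_finite[OF assms(3)]]
      by (intro card_le_if_covered[of "L l" _ W Y]) auto
  qed
  then obtain N where "contained_in G (H \<boxtimes> path_upto N \<boxtimes> clique_graph {..<?m})"
    using contained_in_strong_product[OF assms(3) H(1) L lab(2)] lab(1) by blast
  then show ?thesis
    using H path_graph_path_upto complete_digraph_clique_graph by blast
qed

end
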